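(* Let $X$ be an Asplund space, $p\in[1,\infty)$ and $q\in(1,+\infty]$ with $\frac1p+\frac1q=1$. Let $f\colon T\times X\to\mathbb{R}$ be a Lusin integrand for which there exists $k\in L^q(T;\mathbb{R}_+)$ such that $f_t$ is $k(t)$-Lipschitz for all $t\in T$, and consider $\mathcal{I}_f(x)=\int_Tf_t(x(t))\,d\mu$ on $L^p(T,X)$. Let $x\in L^p(T,X)$ be such that the function $(t,v)\mapsto df_t(x(t))(v)$ is a Lusin integrand. Then $$d\mathcal{I}_f(x)(v)\le\int_T df_t(x(t))(v(t))\,d\mu\quad\text{for all } v\in L^p(T,X).$$ Moreover, $$\overline{\partial}\mathcal{I}_f(x)\subset\{x^\ast\in L^q(T,X^\ast): x^\ast(t)\in\overline{\partial}f_t(x(t))\ \ \mu\text{-a.e.}\}.$$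
   Context: Standing assumptions: $X$ is a (not necessarily separable) Banach space with dual $X^\ast$, $(T,d)$ is a metric space, and $(T,\mathcal{A},\mu)$ is a complete $\sigma$-finite measure space with $\mathcal{A}$ containing the Borel $\sigma$-algebra of $T$; $\mu$ is inner regular, meaning that for all $\varepsilon>0$ and $B\in\mathcal{A}$ of finite measure there is a compact $K\subset B$ with $\mu(B\setminus K)<\varepsilon$. Notation: $f_t(x):=f(t,x)$; $\operatorname{epi} f_t:=\{(x,\alpha)\in X\times\mathbb{R}: f_t(x)\le\alpha\}$. Since $X$ is Asplund and $p<\infty$, the dual of $L^p(T,X)$ is identified with $L^q(T,X^\ast)$. For a real-valued function $g$ on a Banach space $Z$, locally Lipschitz around $z\in Z$: $dg(z)(v):=\limsup_{y\to z,\ s\to0^+}s^{-1}[g(y+sv)-g(y)]$ is the Clarke directional derivative and $\overline{\partial}g(z):=\{z^\ast\in Z^\ast:\langle z^\ast,v\rangle\le dg(z)(v)\ \forall v\in Z\}$ is the Clarke subdifferential. A function $f\colon T\times X\to[-\infty,\infty]$ is a Lusin integrand if for every $\varepsilon>0$ and $A\in\mathcal{A}$ of finite measure there is a compact $B\subset A$ with $\mu(A\setminus B)<\varepsilon$ such that $B\ni t\rightrightarrows\operatorname{epi} f_t$ is lower semicontinuous, i.e. for every $t\in B$ and open $V\subset X\times\mathbb{R}$ with $\operatorname{epi} f_t\cap V\ne\emptyset$ there is a neighbourhood $U$ of $t$ in $B$ with $\operatorname{epi} f_s\cap V\ne\emptyset$ for all $s\in U$. *)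

theory Defs
  imports "HOL-Analysis.Analysis"
begin

text \<open>At points of the open set \<open>U\<close>, \<open>differentiable\<close> means Frechet differentiable.\<close>

definition asplund :: "'a::banach itself \<Rightarrow> bool" where
  "asplund _ \<longleftrightarrow>
    (\<forall>(U :: 'a set) (g :: 'a \<Rightarrow> real).
       open U \<and> convex U \<and> convex_on U g \<and> continuous_on U g \<longrightarrow>
       (\<exists>D\<subseteq>U. gdelta D \<and> U \<subseteq> closure D \<and> (\<forall>z\<in>D. g differentiable (at z))))"

definition inner_regular :: "'t::metric_space measure \<Rightarrow> bool" where
  "inner_regular M \<longleftrightarrow>
    (\<forall>\<epsilon>>0. \<forall>B\<in>sets M. emeasure M B < \<infinity> \<longrightarrow>
       (\<exists>K. compact K \<and> K \<subseteq> B \<and> emeasure M (B - K) < ennreal \<epsilon>))"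

text \<open>Bochner measurability. The library's Bochner integration is restricted to second countable
  types and therefore does not apply to a nonseparable space.\<close>

definition strongly_measurable :: "'t measure \<Rightarrow> ('t \<Rightarrow> 'a::real_normed_vector) \<Rightarrow> bool" where
  "strongly_measurable M u \<longleftrightarrow>
    (\<exists>s. (\<forall>n. simple_function M (s n)) \<and> (AE t in M. (\<lambda>n. s n t) \<longlonglongrightarrow> u t))"

text \<open>Elements of the Lebesgue-Bochner spaces are represented by functions, not by classes modulo
  equality almost everywhere, so \<open>Lp_norm\<close> is a seminorm on \<open>Lp\<close>.\<close>

definition Lp :: "'t measure \<Rightarrow> ennreal \<Rightarrow> ('t \<Rightarrow> 'a::real_normed_vector) set" where
  "Lp M r = {u. strongly_measurable M u \<and>
     (if r = \<infinity> then \<exists>C. AE t in M. norm (u t) \<le> C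
      else integrable M (\<lambda>t. norm (u t) powr enn2real r))}"

definition Lp_norm :: "'t measure \<Rightarrow> ennreal \<Rightarrow> ('t \<Rightarrow> 'a::real_normed_vector) \<Rightarrow> real" where
  "Lp_norm M r u =
     (if r = \<infinity> then Inf {C. 0 \<le> C \<and> (AE t in M. norm (u t) \<le> C)}
      else (\<integral>t. norm (u t) powr enn2real r \<partial>M) powr (1 / enn2real r))"

text \<open>Functionals in \<open>Lp_dual\<close> are arbitrary outside \<open>Lp M r\<close>; boundedness by the seminorm makes them
  respect equality almost everywhere.\<close>

definition Lp_dual :: "'t measure \<Rightarrow> ennreal \<Rightarrow> (('t \<Rightarrow> 'a::real_normed_vector) \<Rightarrow> real) set" where
  "Lp_dual M r = {\<phi>.
     (\<forall>u\<in>Lp M r. \<forall>v\<in>Lp M r. \<phi> (\<lambda>t. u t + v t) = \<phi> u + \<phi> v) \<and>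
     (\<forall>c. \<forall>u\<in>Lp M r. \<phi> (\<lambda>t. c *\<^sub>R u t) = c * \<phi> u) \<and>
     (\<exists>C. \<forall>u\<in>Lp M r. \<bar>\<phi> u\<bar> \<le> C * Lp_norm M r u)}"

definition Lp_nhds :: "'t measure \<Rightarrow> ennreal \<Rightarrow> ('t \<Rightarrow> 'a::real_normed_vector) \<Rightarrow> ('t \<Rightarrow> 'a) filter" where
  "Lp_nhds M r x =
     (INF e\<in>{0<..}. principal {y \<in> Lp M r. Lp_norm M r (\<lambda>t. y t - x t) < e})"

text \<open>The Clarke derivative is extended-real valued, as a limit superior; it is finite if \<open>g\<close> is
  Lipschitz around \<open>z\<close>. The base points \<open>y\<close> may coincide with \<open>z\<close>.\<close>

definition clarke_deriv :: "('a::real_normed_vector \<Rightarrow> real) \<Rightarrow> 'a \<Rightarrow> 'a \<Rightarrow> ereal" where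
  "clarke_deriv g z v =
     Limsup (nhds z \<times>\<^sub>F at_right 0) (\<lambda>(y, s). ereal ((g (y + s *\<^sub>R v) - g y) / s))"

definition clarke_subdiff :: "('a::real_normed_vector \<Rightarrow> real) \<Rightarrow> 'a \<Rightarrow> ('a \<Rightarrow>\<^sub>L real) set" where
  "clarke_subdiff g z = {\<xi>. \<forall>v. ereal (blinfun_apply \<xi> v) \<le> clarke_deriv g z v}"

text \<open>The same two notions for a functional on the seminormed space \<open>Lp M r\<close>, which is not a type.\<close>

definition Lp_clarke_deriv ::
  "'t measure \<Rightarrow> ennreal \<Rightarrow> (('t \<Rightarrow> 'a::real_normed_vector) \<Rightarrow> real) \<Rightarrow> ('t \<Rightarrow> 'a) \<Rightarrow> ('t \<Rightarrow> 'a) \<Rightarrow> ereal" where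
  "Lp_clarke_deriv M r G x v =
     Limsup (Lp_nhds M r x \<times>\<^sub>F at_right 0) (\<lambda>(y, s). ereal ((G (\<lambda>t. y t + s *\<^sub>R v t) - G y) / s))"

definition Lp_clarke_subdiff ::
  "'t measure \<Rightarrow> ennreal \<Rightarrow> (('t \<Rightarrow> 'a::real_normed_vector) \<Rightarrow> real) \<Rightarrow> ('t \<Rightarrow> 'a) \<Rightarrow> (('t \<Rightarrow> 'a) \<Rightarrow> real) set" where
  "Lp_clarke_subdiff M r G x =
     {\<phi> \<in> Lp_dual M r. \<forall>v\<in>Lp M r. ereal (\<phi> v) \<le> Lp_clarke_deriv M r G x v}"

definition epi :: "('a \<Rightarrow> ereal) \<Rightarrow> ('a \<times> real) set" where
  "epi g = {(x, \<alpha>). g x \<le> ereal \<alpha>}"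

definition lsc_multifun_on :: "'t::topological_space set \<Rightarrow> ('t \<Rightarrow> 'b::topological_space set) \<Rightarrow> bool" where
  "lsc_multifun_on B \<Gamma> \<longleftrightarrow>
    (\<forall>t\<in>B. \<forall>V. open V \<and> \<Gamma> t \<inter> V \<noteq> {} \<longrightarrow>
       (\<exists>U. openin (top_of_set B) U \<and> t \<in> U \<and> (\<forall>s\<in>U. \<Gamma> s \<inter> V \<noteq> {})))"

definition lusin_integrand :: "'t::metric_space measure \<Rightarrow> ('t \<Rightarrow> 'a::real_normed_vector \<Rightarrow> ereal) \<Rightarrow> bool" where
  "lusin_integrand M f \<longleftrightarrow>
    (\<forall>\<epsilon>>0. \<forall>A\<in>sets M. emeasure M A < \<infinity> \<longrightarrow>
       (\<exists>B. compact B \<and> B \<subseteq> A \<and> emeasure M (A - B) < ennreal \<epsilon> \<and>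
            lsc_multifun_on B (\<lambda>t. epi (f t))))"

text \<open>The integral is \<open>0\<close> by convention when the integrand is not integrable. If each \<open>f t\<close> is
  \<open>k t\<close>-Lipschitz with \<open>k\<close> in the dual exponent space, and \<open>f\<close> is a Lusin integrand, then
  integrability of the integrand at one \<open>u\<close> in \<open>Lp M p\<close> gives it at all of them, and the
  functional is real-valued on \<open>Lp M p\<close>.\<close>

definition int_functional :: "'t measure \<Rightarrow> ('t \<Rightarrow> 'a \<Rightarrow> real) \<Rightarrow> ('t \<Rightarrow> 'a) \<Rightarrow> real" where
  "int_functional M f u = (\<integral>t. f t (u t) \<partial>M)"

end

theory Submission
  imports Defs
begin

text \<open>
  The estimate of the directional derivative is a Fatou argument. Along \<open>y\<^sub>n \<rightarrow> x\<close> in \<open>L\<^sup>p\<close> and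
  \<open>s\<^sub>n \<rightarrow> 0+\<close> the difference quotients of the integral functional are the integrals of the pointwise
  ones, these are dominated by \<open>k \<parallel>v\<parallel>\<close>, and after passing to a subsequence with \<open>y\<^sub>n(t) \<rightarrow> x(t)\<close>
  almost everywhere their upper limit at \<open>t\<close> is at most \<open>df\<^sub>t(x(t))(v(t))\<close>
  (lemma \<open>Lp_clarke_deriv_le\<close>).

  Consequently a Clarke subgradient \<open>\<phi>\<close> satisfies
  \<open>\<phi>(v) \<le> \<integral> df\<^sub>t(x(t))(v(t)) \<le> \<integral> k \<parallel>v\<parallel>\<close>. For fixed \<open>z\<close> the set function \<open>E \<mapsto> \<phi>(1\<^sub>E z)\<close>, suitably
  weighted, is then dominated by a finite measure and has a Radon-Nikodym density \<open>u\<^sub>z\<close>. These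
  densities are additive and homogeneous in \<open>z\<close> up to null sets that depend on \<open>z\<close>, and the point is
  to find a single strongly measurable \<open>\<xi>\<close> with values in the dual such that \<open>\<xi>(t)(z) = u\<^sub>z(t)\<close> almost
  everywhere for each \<open>z\<close>. Here the Asplund property enters. For a set \<open>E\<close> of positive measure the
  function \<open>\<sigma>(z) = ess sup\<^sub>E u\<^sub>z\<close> is sublinear and continuous, hence Frechet differentiable at some
  \<open>z\<^sub>0\<close>, with derivative \<open>L\<close> say. Where \<open>u\<close> at \<open>z\<^sub>0\<close> almost attains \<open>\<sigma>(z\<^sub>0)\<close>, the identity
  \<open>u\<^sub>h = u\<^bsub>z\<^sub>0 + h\<^esub> - u\<^bsub>z\<^sub>0\<^esub>\<close> forces \<open>u\<^sub>h\<close> to be at most \<open>\<sigma>(z\<^sub>0 + h) - \<sigma>(z\<^sub>0)\<close> plus a small error, so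
  \<open>\<bar>u\<^sub>h - L h\<bar> \<le> \<epsilon> \<parallel>h\<parallel>\<close> there for all \<open>h\<close>, by homogeneity (lemma
  \<open>asplund_small_oscillation_piece\<close>). Exhausting the space by such pieces yields functionals with
  countably many values that converge uniformly to \<open>\<xi>\<close> as \<open>\<epsilon> \<rightarrow> 0\<close> (lemma \<open>asplund_dual_density\<close>).

  Testing \<open>\<phi>\<close> with functions supported on small sets gives \<open>\<xi>(t)(z) \<le> df\<^sub>t(x(t))(z)\<close> for almost every
  \<open>t\<close>, separately for each \<open>z\<close>. No countable set of directions suffices in a nonseparable space;
  the Lusin property takes over that role. On a compact set on which \<open>\<xi>\<close> is nearly constant, \<open>k\<close> is
  bounded and the epigraphs of \<open>df\<^sub>t(x(t))\<close> are lower semicontinuous, a violation at \<open>t\<close> in direction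
  \<open>z\<close> persists in the same direction near \<open>t\<close>. Points of violation thus have null neighbourhoods, and
  by inner regularity they form a null set (lemma \<open>AE_all_directions\<close>).
\<close>

section \<open>Strong measurability over a complete measure\<close>

lemma (in complete_measure) measurable_AE_cong:
  assumes g: "g \<in> measurable M N" and ae: "AE t in M. f t = g t"
    and f: "f \<in> space M \<rightarrow> space N"
  shows "f \<in> measurable M N"
proof (rule measurableI)
  show "f t \<in> space N" if "t \<in> space M" for t using f that by auto
  fix A assume "A \<in> sets N"
  then have "g -` A \<inter> space M \<in> sets M" using g by (rule measurable_sets[rotated])
  then show "f -` A \<inter> space M \<in> sets M"
    by (rule in_sets_AE[rotated]) (use ae in \<open>auto elim: eventually_mono\<close>)
qed

lemma (in complete_measure) borel_measurable_AE_LIMSEQ: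
  fixes s :: "nat \<Rightarrow> 'a \<Rightarrow> real"
  assumes s: "\<And>n. s n \<in> borel_measurable M"
    and lim: "AE t in M. (\<lambda>n. s n t) \<longlonglongrightarrow> g t"
  shows "g \<in> borel_measurable M"
proof (rule measurable_AE_cong)
  show "(\<lambda>t. lim (\<lambda>n. s n t)) \<in> borel_measurable M"
    using s by measurable
  show "AE t in M. g t = lim (\<lambda>n. s n t)"
    using lim by eventually_elim (simp add: limI)
qed auto

lemma strongly_measurable_simple:
  "simple_function M s \<Longrightarrow> strongly_measurable M s"
  unfolding strongly_measurable_def by (intro exI[of _ "\<lambda>_. s"]) auto

text \<open>The values of a simple function carry no structure, so any binary operation maps simple functions
  to simple functions and only the passage to the limit needs continuity.\<close>

lemma strongly_measurable_compose2:
  assumes u: "strongly_measurable M u" and v: "strongly_measurable M v"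
    and h: "continuous_on UNIV (\<lambda>z. h (fst z) (snd z))"
  shows "strongly_measurable M (\<lambda>t. h (u t) (v t))"
proof -
  obtain r s where r: "\<And>n. simple_function M (r n)" "AE t in M. (\<lambda>n. r n t) \<longlonglongrightarrow> u t"
    and s: "\<And>n. simple_function M (s n)" "AE t in M. (\<lambda>n. s n t) \<longlonglongrightarrow> v t"
    using u v unfolding strongly_measurable_def by blast
  have "AE t in M. (\<lambda>n. h (r n t) (s n t)) \<longlonglongrightarrow> h (u t) (v t)"
    using r(2) s(2)
  proof eventually_elim
    case (elim t)
    have "(\<lambda>n. (r n t, s n t)) \<longlonglongrightarrow> (u t, v t)"
      using elim by (rule tendsto_Pair)
    from continuous_on_tendsto_compose[OF h this] show ?case by simp
  qed
  then show ?thesis unfolding strongly_measurable_def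
    using simple_function_compose2[OF r(1) s(1), of h] by (intro exI[of _ "\<lambda>n t. h (r n t) (s n t)"]) auto
qed

lemma strongly_measurable_add:
  "strongly_measurable M u \<Longrightarrow> strongly_measurable M v \<Longrightarrow> strongly_measurable M (\<lambda>t. u t + v t)"
  by (rule strongly_measurable_compose2) (auto intro!: continuous_intros)

lemma strongly_measurable_diff:
  "strongly_measurable M u \<Longrightarrow> strongly_measurable M v \<Longrightarrow> strongly_measurable M (\<lambda>t. u t - v t)"
  by (rule strongly_measurable_compose2) (auto intro!: continuous_intros)

lemma strongly_measurable_scaleR:
  "strongly_measurable M r \<Longrightarrow> strongly_measurable M v \<Longrightarrow> strongly_measurable M (\<lambda>t. r t *\<^sub>R v t)"
  by (rule strongly_measurable_compose2) (auto intro!: continuous_intros)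

lemma strongly_measurable_real:
  fixes u :: "'t \<Rightarrow> real"
  assumes "u \<in> borel_measurable M"
  shows "strongly_measurable M u"
  unfolding strongly_measurable_def
  using borel_measurable_implies_sequence_metric[OF assms, of 0] by (meson AE_I2)

lemma (in complete_measure) strongly_measurable_imp_borel:
  fixes u :: "'a \<Rightarrow> real"
  assumes "strongly_measurable M u"
  shows "u \<in> borel_measurable M"
  using assms borel_measurable_AE_LIMSEQ unfolding strongly_measurable_def
  by (metis borel_measurable_simple_function)

lemma (in complete_measure) borel_measurable_norm_strong:
  assumes "strongly_measurable M u"
  shows "(\<lambda>t. norm (u t)) \<in> borel_measurable M"
  by (rule strongly_measurable_imp_borel,
      rule strongly_measurable_compose2[OF assms assms, where h = "\<lambda>a b. norm a"])
     (auto intro!: continuous_intros)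

lemma (in complete_measure) borel_measurable_blinfun_strong:
  fixes \<xi> :: "'a \<Rightarrow> 'b::real_normed_vector \<Rightarrow>\<^sub>L real"
  assumes "strongly_measurable M \<xi>" "strongly_measurable M v"
  shows "(\<lambda>t. blinfun_apply (\<xi> t) (v t)) \<in> borel_measurable M"
  by (rule strongly_measurable_imp_borel, rule strongly_measurable_compose2[OF assms])
     (auto intro!: continuous_intros)

lemma strongly_measurable_indicator:
  assumes "E \<in> sets M" "strongly_measurable M v"
  shows "strongly_measurable M (\<lambda>t. indicat_real E t *\<^sub>R v t)"
  using assms by (intro strongly_measurable_scaleR strongly_measurable_real) auto

section \<open>Exhaustion\<close>

text \<open>Among all countable unions of sets with property \<open>P\<close>, one has the largest measure with respect to an
  equivalent finite measure. Its complement contains no further \<open>P\<close>-set of positive measure, so it is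
  null.\<close>

lemma (in sigma_finite_measure) countable_cover_by_exhaustion:
  assumes P: "\<And>E. E \<in> sets M \<Longrightarrow> emeasure M E > 0 \<Longrightarrow>
      \<exists>F. F \<subseteq> E \<and> F \<in> sets M \<and> emeasure M F > 0 \<and> P F"
    and P0: "P {}"
  obtains F :: "nat \<Rightarrow> 'a set"
  where "\<And>i. F i \<in> sets M" "\<And>i. P (F i)" "AE t in M. \<exists>i. t \<in> F i"
proof -
  obtain h :: "'a \<Rightarrow> real" where h: "h \<in> borel_measurable M" "\<And>t. h t > 0" "integrable M h"
    using obtain_positive_integrable_function by metis
  define W where "W = density M h"
  have setsW[simp]: "sets W = sets M" unfolding W_def by simp
  interpret W: finite_measure W
  proof
    have "emeasure W (space W) = (\<integral>\<^sup>+t. ennreal (h t) \<partial>M)"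
      unfolding W_def using h by (simp add: emeasure_density cong: nn_integral_cong)
    also have "\<dots> < \<infinity>" using h by (simp add: nn_integral_eq_integral less_imp_le)
    finally show "emeasure W (space W) \<noteq> \<infinity>" by simp
  qed
  \<comment> \<open>The two measures have the same null sets because the density is positive.\<close>
  have nullW: "emeasure M N = 0" if N: "N \<in> sets M" "emeasure W N = 0" for N
  proof -
    have "N \<in> null_sets (density M h)" using N unfolding W_def by auto
    then have "AE t in M. t \<in> N \<longrightarrow> ennreal (h t) = 0"
      using h(1) by (subst (asm) null_sets_density_iff) auto
    then have "AE t in M. t \<notin> N"
      by eventually_elim (metis h(2) ennreal_eq_0_iff not_le)
    then have "N \<in> null_sets M" using N(1) by (simp add: AE_iff_null_sets)
    then show ?thesis by auto
  qed
  define \<G> where "\<G> = {F :: nat \<Rightarrow> 'a set. \<forall>i. F i \<in> sets M \<and> P (F i)}"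
  define m where "m F = emeasure W (\<Union>i. F i)" for F :: "nat \<Rightarrow> 'a set"
  have "(\<lambda>_. {}) \<in> \<G>" using P0 unfolding \<G>_def by auto
  then have "\<G> \<noteq> {}" by auto
  from ennreal_SUP_countable_SUP[OF this, of m] obtain f :: "nat \<Rightarrow> ennreal" where
    f: "range f \<subseteq> m ` \<G>" "Sup (m ` \<G>) = Sup (range f)" by blast
  then have "\<forall>n. \<exists>G\<in>\<G>. f n = m G" by blast
  then obtain G where G: "\<And>n. G n \<in> \<G>" "\<And>n. f n = m (G n)" by metis
  \<comment> \<open>All families of a maximizing sequence of families are enumerated as one family.\<close>
  define H where "H i = (case prod_decode i of (a, b) \<Rightarrow> G a b)" for i
  have H: "H \<in> \<G>" using G(1) unfolding \<G>_def H_def by (auto split: prod.split)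
  have GH: "G a b = H (prod_encode (a, b))" for a b unfolding H_def by simp
  have sH: "H i \<in> sets M" for i using H unfolding \<G>_def by auto
  have max: "m K \<le> m H" if "K \<in> \<G>" for K
  proof -
    have "f n \<le> m H" for n
      unfolding G(2) m_def using sH GH by (intro emeasure_mono) auto
    then have "Sup (m ` \<G>) \<le> m H" unfolding f(2) by (intro SUP_least) auto
    then show ?thesis using that by (meson SUP_le_iff)
  qed
  have "emeasure M (space M - (\<Union>i. H i)) = 0"
  proof (rule ccontr)
    assume "\<not> ?thesis"
    then obtain F where F: "F \<subseteq> space M - (\<Union>i. H i)" "F \<in> sets M" "emeasure M F > 0" "P F"
      using P[of "space M - (\<Union>i. H i)"] sH by (auto simp: zero_less_iff_neq_zero)
    define K where "K i = (case i of 0 \<Rightarrow> F | Suc j \<Rightarrow> H j)" for i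
    have "K \<in> \<G>" using F H unfolding \<G>_def K_def by (auto split: nat.split)
    have UK: "(\<Union>i. K i) = F \<union> (\<Union>i. H i)"
      unfolding K_def by (auto split: nat.splits)
    have "m K = emeasure W F + m H"
      unfolding m_def UK using F sH by (intro plus_emeasure[symmetric]) auto
    with max[OF \<open>K \<in> \<G>\<close>] have "emeasure W F = 0"
      unfolding m_def using W.emeasure_finite[of "\<Union>i. H i"]
      by (metis add.commute ennreal_add_left_cancel_le add_0_right le_zero_eq infinity_ennreal_def)
    with nullW F show False by auto
  qed
  then have "AE t in M. \<exists>i. t \<in> H i"
    using sH by (intro AE_I[of _ _ "space M - (\<Union>i. H i)"]) auto
  with H that show ?thesis unfolding \<G>_def by blast
qed

lemma (in sigma_finite_measure) AE_by_exhaustion: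
  assumes "\<And>E. E \<in> sets M \<Longrightarrow> emeasure M E > 0 \<Longrightarrow>
      \<exists>F. F \<subseteq> E \<and> F \<in> sets M \<and> emeasure M F > 0 \<and> (AE t in M. t \<in> F \<longrightarrow> Q t)"
  shows "AE t in M. Q t"
proof -
  obtain F :: "nat \<Rightarrow> 'a set" where
    F: "\<And>i. AE t in M. t \<in> F i \<longrightarrow> Q t" and cov: "AE t in M. \<exists>i. t \<in> F i"
    by (rule countable_cover_by_exhaustion[of "\<lambda>F. AE t in M. t \<in> F \<longrightarrow> Q t"]) (use assms in auto)
  from F have "AE t in M. \<forall>i. t \<in> F i \<longrightarrow> Q t" by (subst AE_all_countable) auto
  with cov show ?thesis by eventually_elim auto
qed

section \<open>Superposition with a Lusin integrand\<close>

lemma (in sigma_finite_measure) finite_subset_positive: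
  assumes "E \<in> sets M" "emeasure M E > 0"
  obtains F where "F \<subseteq> E" "F \<in> sets M" "0 < emeasure M F" "emeasure M F < \<infinity>"
proof (rule ccontr)
  assume no: "\<not> thesis"
  obtain A :: "nat \<Rightarrow> 'a set" where A: "range A \<subseteq> sets M" "(\<Union>i. A i) = space M" "\<And>i. emeasure M (A i) \<noteq> \<infinity>"
    using sigma_finite by metis
  have "emeasure M (E \<inter> A i) = 0" for i
  proof (rule ccontr)
    assume "emeasure M (E \<inter> A i) \<noteq> 0"
    moreover have "emeasure M (E \<inter> A i) \<le> emeasure M (A i)"
      using A assms by (intro emeasure_mono) auto
    ultimately have "emeasure M (E \<inter> A i) < \<infinity>" "emeasure M (E \<inter> A i) > 0"
      using A(3)[of i] by (auto simp: zero_less_iff_neq_zero top.not_eq_extremum)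
    with no that[of "E \<inter> A i"] A assms show False by auto
  qed
  then have "(\<Union>i. E \<inter> A i) \<in> null_sets M" using A assms by (intro null_sets_UN) auto
  moreover have "(\<Union>i. E \<inter> A i) = E" using A sets.sets_into_space[OF assms(1)] by auto
  ultimately show False using assms by auto
qed

text \<open>The Lusin property is applied with the measure of \<open>A\<close> itself as tolerance: what remains then has
  positive measure.\<close>

lemma lusin_positive_compact:
  fixes M :: "'t::metric_space measure"
  assumes l: "lusin_integrand M g" and A: "A \<in> sets M" "0 < emeasure M A" "emeasure M A < \<infinity>"
    and borel: "sets borel \<subseteq> sets M"
  obtains B where "compact B" "B \<subseteq> A" "B \<in> sets M" "0 < emeasure M B"
    "lsc_multifun_on B (\<lambda>t. epi (g t))"
proof -
  define \<epsilon> where "\<epsilon> = enn2real (emeasure M A)"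
  have e: "\<epsilon> > 0" "ennreal \<epsilon> = emeasure M A"
    using A unfolding \<epsilon>_def by (auto simp: enn2real_positive_iff)
  obtain B where B: "compact B" "B \<subseteq> A" "emeasure M (A - B) < ennreal \<epsilon>"
    "lsc_multifun_on B (\<lambda>t. epi (g t))"
    using l A e(1) unfolding lusin_integrand_def by blast
  have sB: "B \<in> sets M" using borel borel_closed[OF compact_imp_closed[OF B(1)]] by auto
  have "emeasure M B \<noteq> 0"
  proof
    assume "emeasure M B = 0"
    then have "emeasure M (A - B) = emeasure M A"
      using sB A by (intro emeasure_Diff_null_set) auto
    with B(3) e(2) show False by simp
  qed
  then show ?thesis using that B sB by (auto simp: zero_less_iff_neq_zero)
qed

text \<open>The condition on \<open>s\<close> says that the epigraph of \<open>g s\<close> meets the open set \<open>V \<times> {..<\<beta>}\<close>. This is the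
  only way in which lower semicontinuity of the epigraphs is used.\<close>

lemma sublevel_openin_lsc:
  assumes l: "lsc_multifun_on B (\<lambda>t. epi (\<lambda>z. ereal (g t z)))"
    and V: "open V"
  shows "openin (top_of_set B) {s\<in>B. \<exists>y\<in>V. g s y < \<beta>}"
proof (subst openin_subopen, intro ballI)
  fix t assume "t \<in> {s\<in>B. \<exists>y\<in>V. g s y < \<beta>}"
  then obtain y where y: "t \<in> B" "y \<in> V" "g t y < \<beta>" by auto
  have "open (V \<times> {..<\<beta>})" using V by (intro open_Times) auto
  moreover have "(y, g t y) \<in> epi (\<lambda>z. ereal (g t z)) \<inter> V \<times> {..<\<beta>}"
    using y by (auto simp: epi_def)
  ultimately obtain U where U: "openin (top_of_set B) U" "t \<in> U"
    "\<forall>s\<in>U. epi (\<lambda>z. ereal (g s z)) \<inter> V \<times> {..<\<beta>} \<noteq> {}"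
    using l y(1) unfolding lsc_multifun_on_def by blast
  have "U \<subseteq> {s\<in>B. \<exists>y\<in>V. g s y < \<beta>}"
  proof
    fix s assume "s \<in> U"
    then obtain z a where "(z, a) \<in> epi (\<lambda>z. ereal (g s z))" "z \<in> V" "a < \<beta>"
      using U(3) by blast
    then have "z \<in> V" "g s z < \<beta>" by (auto simp: epi_def)
    then show "s \<in> {s\<in>B. \<exists>y\<in>V. g s y < \<beta>}"
      using openin_subset[OF U(1)] \<open>s \<in> U\<close> by auto
  qed
  with U show "\<exists>T. openin (top_of_set B) T \<and> t \<in> T \<and> T \<subseteq> {s\<in>B. \<exists>y\<in>V. g s y < \<beta>}"
    by blast
qed

lemma openin_compact_sets:
  fixes M :: "'t::metric_space measure"
  assumes "sets borel \<subseteq> sets M" "compact B" "openin (top_of_set B) U"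
  shows "U \<in> sets M"
proof -
  obtain W where "open W" "U = B \<inter> W" using assms(3) by (auto simp: openin_open)
  moreover have "B \<in> sets borel" using borel_closed[OF compact_imp_closed[OF assms(2)]] .
  ultimately have "U \<in> sets borel" by auto
  then show ?thesis using assms(1) by auto
qed

text \<open>The function is Borel on each compact set supplied by the Lusin property; countably many of these cover
  almost everything, and completeness takes care of the rest.\<close>

lemma lusin_integrand_slice_measurable:
  fixes M :: "'t::metric_space measure"
  assumes "complete_measure M" "sigma_finite_measure M" and sp: "space M = UNIV"
    and borel: "sets borel \<subseteq> sets M"
    and l: "lusin_integrand M (\<lambda>t z. ereal (g t z))"
    and cont: "\<And>t. continuous_on UNIV (g t)"
  shows "(\<lambda>t. g t c) \<in> borel_measurable M"
proof -
  interpret complete_measure M by fact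
  interpret sigma_finite_measure M by fact
  let ?P = "\<lambda>F. (\<lambda>t. g t c) \<in> borel_measurable (restrict_space M F)"
  have "\<exists>F. F \<subseteq> E \<and> F \<in> sets M \<and> emeasure M F > 0 \<and> ?P F"
    if E: "E \<in> sets M" "emeasure M E > 0" for E
  proof -
    obtain A where A: "A \<subseteq> E" "A \<in> sets M" "0 < emeasure M A" "emeasure M A < \<infinity>"
      using finite_subset_positive[OF E] .
    obtain B where B: "compact B" "B \<subseteq> A" "B \<in> sets M" "0 < emeasure M B"
      "lsc_multifun_on B (\<lambda>t. epi (\<lambda>z. ereal (g t z)))"
      using lusin_positive_compact[OF l A(2-4) borel] .
    define O' where "O' n \<beta> = {s\<in>B. \<exists>y\<in>ball c (1 / real (Suc n)). g s y < \<beta>}" for n \<beta>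
    have O': "O' n \<beta> \<in> sets M" for n \<beta>
      unfolding O'_def by (rule openin_compact_sets[OF borel B(1)])
        (rule sublevel_openin_lsc[OF B(5)], simp)
    \<comment> \<open>The infimum of \<open>g s\<close> over shrinking balls tends to \<open>g s c\<close> by continuity; the rational \<open>\<beta>\<close> keeps the
      limit strictly below \<open>a\<close>.\<close>
    have eq: "{s\<in>B. g s c < a} = (\<Union>\<beta>\<in>{\<beta>\<in>\<rat>. \<beta> < a}. \<Inter>n. O' n \<beta>)" for a
    proof (intro equalityI subsetI)
      fix s assume "s \<in> {s\<in>B. g s c < a}"
      then have s: "s \<in> B" "g s c < a" by auto
      obtain \<beta> where \<beta>: "\<beta> \<in> \<rat>" "g s c < \<beta>" "\<beta> < a" using Rats_dense_in_real[OF s(2)] by auto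
      then have "s \<in> O' n \<beta>" for n
        unfolding O'_def using s by (auto intro!: bexI[of _ c])
      with \<beta> show "s \<in> (\<Union>\<beta>\<in>{\<beta>\<in>\<rat>. \<beta> < a}. \<Inter>n. O' n \<beta>)" by auto
    next
      fix s assume "s \<in> (\<Union>\<beta>\<in>{\<beta>\<in>\<rat>. \<beta> < a}. \<Inter>n. O' n \<beta>)"
      then obtain \<beta> where \<beta>: "\<beta> < a" "\<And>n. s \<in> O' n \<beta>" by auto
      then have "\<forall>n. \<exists>y. y \<in> ball c (1 / real (Suc n)) \<and> g s y < \<beta>"
        unfolding O'_def by blast
      then obtain y where y: "\<And>n. y n \<in> ball c (1 / real (Suc n))" "\<And>n. g s (y n) < \<beta>"
        by metis
      have "(\<lambda>n. 1 / real (Suc n)) \<longlonglongrightarrow> 0"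
        using LIMSEQ_inverse_real_of_nat by (simp add: inverse_eq_divide)
      then have "(\<lambda>n. dist (y n) c) \<longlonglongrightarrow> 0"
        by (rule real_tendsto_sandwich[OF _ _ tendsto_const, rotated 2])
           (use y(1) in \<open>auto simp: dist_commute intro!: always_eventually less_imp_le\<close>)
      then have "y \<longlonglongrightarrow> c" by (rule tendsto_dist_iff[THEN iffD2])
      then have "(\<lambda>n. g s (y n)) \<longlonglongrightarrow> g s c"
        using continuous_on_tendsto_compose[OF cont] by auto
      then have "g s c \<le> \<beta>"
        by (rule LIMSEQ_le_const2) (auto intro: less_imp_le y(2))
      moreover have "s \<in> B" using \<beta>(2)[of 0] unfolding O'_def by auto
      ultimately show "s \<in> {s\<in>B. g s c < a}" using \<beta>(1) by auto
    qed
    have "countable {\<beta>\<in>\<rat>. \<beta> < a}" for a :: real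
      using countable_rat by (rule countable_subset[rotated]) auto
    then have "{s\<in>B. g s c < a} \<in> sets M" for a
      unfolding eq using O' by (intro sets.countable_UN' sets.countable_INT'') auto
    then have "?P B" using B(3) sp
      by (intro borel_measurableI_less) (auto simp: sets_restrict_space_iff space_restrict_space)
    then show ?thesis using A B by (intro exI[of _ B]) auto
  qed
  moreover have "?P {}" by (intro measurableI) (auto simp: space_restrict_space sets_restrict_space)
  ultimately obtain F :: "nat \<Rightarrow> 't set" where F: "\<And>i. F i \<in> sets M" "\<And>i. ?P (F i)"
    and cov: "AE t in M. \<exists>i. t \<in> F i"
    using countable_cover_by_exhaustion[of ?P] by metis
  show ?thesis
  proof (rule measurable_AE_cong)
    let ?h = "\<lambda>t. if t \<in> (\<Union>i. F i) then g t c else 0"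
    show "AE t in M. g t c = ?h t" using cov by eventually_elim auto
    show "?h \<in> borel_measurable M"
    proof (rule measurable_piecewise_restrict[of "insert (UNIV - (\<Union>i. F i)) (range F)"])
      fix \<Omega> assume "\<Omega> \<in> insert (UNIV - (\<Union>i. F i)) (range F)"
      then consider "\<Omega> = UNIV - (\<Union>i. F i)" | i where "\<Omega> = F i" by auto
      then show "?h \<in> borel_measurable (restrict_space M \<Omega>)"
      proof cases
        case 1
        have "?h \<in> borel_measurable (restrict_space M \<Omega>) \<longleftrightarrow>
            (\<lambda>_. 0 :: real) \<in> borel_measurable (restrict_space M \<Omega>)"
          by (rule measurable_cong) (auto simp: space_restrict_space 1)
        then show ?thesis by simp
      next
        case 2
        have "?h \<in> borel_measurable (restrict_space M \<Omega>) \<longleftrightarrow> ?P \<Omega>"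
          by (rule measurable_cong) (auto simp: space_restrict_space 2)
        then show ?thesis using F(2) 2 by simp
      qed
    next
      fix \<Omega> assume "\<Omega> \<in> insert (UNIV - (\<Union>i. F i)) (range F)"
      moreover have "UNIV - (\<Union>i. F i) \<in> sets M"
        using F(1) sets.compl_sets[of "\<Union>i. F i" M] unfolding sp by blast
      ultimately show "\<Omega> \<inter> space M \<in> sets M" using F(1) unfolding sp by auto
    qed auto
  qed auto
qed

lemma lusin_integrand_superposition_measurable:
  fixes M :: "'t::metric_space measure"
  assumes "complete_measure M" "sigma_finite_measure M" and sp: "space M = UNIV"
    and borel: "sets borel \<subseteq> sets M"
    and l: "lusin_integrand M (\<lambda>t z. ereal (g t z))"
    and cont: "\<And>t. continuous_on UNIV (g t)"
    and u: "strongly_measurable M u"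
  shows "(\<lambda>t. g t (u t)) \<in> borel_measurable M"
proof -
  interpret complete_measure M by fact
  obtain s where s: "\<And>n. simple_function M (s n)" "AE t in M. (\<lambda>n. s n t) \<longlonglongrightarrow> u t"
    using u unfolding strongly_measurable_def by blast
  show ?thesis
  proof (rule borel_measurable_AE_LIMSEQ)
    show "(\<lambda>t. g t (s n t)) \<in> borel_measurable M" for n
    proof (rule measurable_piecewise_restrict[of "(\<lambda>c. s n -` {c} \<inter> space M) ` (s n ` space M)"])
      show "countable ((\<lambda>c. s n -` {c} \<inter> space M) ` (s n ` space M))"
        using simple_functionD(1)[OF s(1)[of n]] by (simp add: countable_finite)
    next
      fix \<Omega> assume "\<Omega> \<in> (\<lambda>c. s n -` {c} \<inter> space M) ` (s n ` space M)"
      then obtain c where c: "\<Omega> = s n -` {c} \<inter> space M" by auto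
      then show "\<Omega> \<inter> space M \<in> sets M" using simple_functionD(2)[OF s(1)[of n]] by auto
      have "(\<lambda>t. g t c) \<in> borel_measurable (restrict_space M \<Omega>)"
        by (intro measurable_restrict_space1 lusin_integrand_slice_measurable assms)
      then show "(\<lambda>t. g t (s n t)) \<in> borel_measurable (restrict_space M \<Omega>)"
        by (rule measurable_cong[THEN iffD2, rotated]) (auto simp: space_restrict_space c)
    qed auto
    show "AE t in M. (\<lambda>n. g t (s n t)) \<longlonglongrightarrow> g t (u t)"
      using s(2) by eventually_elim (auto intro: continuous_on_tendsto_compose[OF cont])
  qed
qed

section \<open>The Clarke derivative of a Lipschitz function\<close>

lemma clarke_filter_nontrivial: "nhds (z::'a::real_normed_vector) \<times>\<^sub>F at_right (0::real) \<noteq> bot"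
  by (simp add: prod_filter_eq_bot)

lemma eventually_clarke_filterI:
  assumes "\<And>y s. 0 < s \<Longrightarrow> P (y, s)"
  shows "eventually P (F \<times>\<^sub>F at_right (0::real))"
proof -
  have "\<forall>\<^sub>F ys in F \<times>\<^sub>F at_right (0::real). 0 < snd ys"
    using eventually_compose_filterlim[OF eventually_at_right_less filterlim_snd] by blast
  then show ?thesis by eventually_elim (metis assms prod.collapse)
qed

lemma lipschitz_quotient_le:
  fixes g :: "'a::real_normed_vector \<Rightarrow> real"
  assumes "L-lipschitz_on UNIV g" "0 < s"
  shows "(g (y + s *\<^sub>R v) - g y) / s \<le> (g (y + s *\<^sub>R w) - g y) / s + L * norm (v - w)"
    and "\<bar>(g (y + s *\<^sub>R v) - g y) / s\<bar> \<le> L * norm v"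
proof -
  have *: "\<bar>g a - g b\<bar> \<le> L * norm (a - b)" for a b
    using lipschitz_onD[OF assms(1), of a b] by (simp add: dist_norm)
  have "g (y + s *\<^sub>R v) - g (y + s *\<^sub>R w) \<le> L * norm (s *\<^sub>R (v - w))"
    using *[of "y + s *\<^sub>R v" "y + s *\<^sub>R w"] by (simp add: scaleR_diff_right)
  then have "g (y + s *\<^sub>R v) - g (y + s *\<^sub>R w) \<le> L * (s * norm (v - w))"
    using assms(2) by simp
  then show "(g (y + s *\<^sub>R v) - g y) / s \<le> (g (y + s *\<^sub>R w) - g y) / s + L * norm (v - w)"
    using assms(2) by (simp add: field_simps del: scaleR_diff_right)
  have "\<bar>g (y + s *\<^sub>R v) - g y\<bar> \<le> L * (s * norm v)"
    using *[of "y + s *\<^sub>R v" y] assms(2) by simp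
  then show "\<bar>(g (y + s *\<^sub>R v) - g y) / s\<bar> \<le> L * norm v"
    using assms(2) by (simp add: field_simps)
qed

text \<open>All three statements pass from the difference quotients to their upper limit. In particular the
  conversion to a real number loses nothing.\<close>

lemma clarke_deriv_lipschitz:
  fixes g :: "'a::real_normed_vector \<Rightarrow> real"
  assumes L: "L-lipschitz_on UNIV g"
  shows clarke_deriv_finite: "clarke_deriv g z v = ereal (real_of_ereal (clarke_deriv g z v))"
    and clarke_deriv_bound: "\<bar>real_of_ereal (clarke_deriv g z v)\<bar> \<le> L * norm v"
    and clarke_deriv_le_add:
      "real_of_ereal (clarke_deriv g z v) \<le> real_of_ereal (clarke_deriv g z w) + L * norm (v - w)"
proof -
  have bound: "clarke_deriv g z v \<le> ereal (L * norm v)" "ereal (- (L * norm v)) \<le> clarke_deriv g z v" for v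
  proof -
    have ev: "\<forall>\<^sub>F (y, s) in nhds z \<times>\<^sub>F at_right 0. \<bar>(g (y + s *\<^sub>R v) - g y) / s\<bar> \<le> L * norm v"
      by (rule eventually_clarke_filterI) (use lipschitz_quotient_le(2)[OF L] in simp)
    show "clarke_deriv g z v \<le> ereal (L * norm v)" unfolding clarke_deriv_def
      by (rule Limsup_bounded, rule eventually_mono[OF ev]) (auto simp: abs_le_iff simp del: abs_divide)
    show "ereal (- (L * norm v)) \<le> clarke_deriv g z v" unfolding clarke_deriv_def
      by (rule le_Limsup[OF clarke_filter_nontrivial], rule eventually_mono[OF ev]) (auto simp: abs_le_iff simp del: abs_divide)
  qed
  have fin: "clarke_deriv g z v = ereal (real_of_ereal (clarke_deriv g z v))" for v
    using bound[of v] by (cases "clarke_deriv g z v") auto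
  show "clarke_deriv g z v = ereal (real_of_ereal (clarke_deriv g z v))" by (rule fin)
  show "\<bar>real_of_ereal (clarke_deriv g z v)\<bar> \<le> L * norm v"
    using bound[of v] by (cases "clarke_deriv g z v") auto
  have "clarke_deriv g z v \<le> ereal (real_of_ereal (clarke_deriv g z w) + L * norm (v - w))"
    unfolding clarke_deriv_def[of g z v]
  proof (subst Limsup_le_iff, intro allI impI)
    fix b assume "ereal (real_of_ereal (clarke_deriv g z w) + L * norm (v - w)) < b"
    then obtain r where r: "real_of_ereal (clarke_deriv g z w) + L * norm (v - w) < r" "ereal r < b"
      using ereal_dense2[of "ereal (real_of_ereal (clarke_deriv g z w) + L * norm (v - w))" b] by auto
    then have "clarke_deriv g z w < ereal (r - L * norm (v - w))"
      by (subst fin) simp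
    then have "\<forall>\<^sub>F (y, s) in nhds z \<times>\<^sub>F at_right 0. ereal ((g (y + s *\<^sub>R w) - g y) / s) < ereal (r - L * norm (v - w))"
      unfolding clarke_deriv_def by (drule_tac Limsup_lessD) (simp add: case_prod_unfold)
    moreover have "\<forall>\<^sub>F (y, s) in nhds z \<times>\<^sub>F at_right 0.
        (g (y + s *\<^sub>R v) - g y) / s \<le> (g (y + s *\<^sub>R w) - g y) / s + L * norm (v - w)"
      by (rule eventually_clarke_filterI) (use lipschitz_quotient_le(1)[OF L] in simp)
    ultimately show "\<forall>\<^sub>F ys in nhds z \<times>\<^sub>F at_right 0. (case ys of (y, s) \<Rightarrow> ereal ((g (y + s *\<^sub>R v) - g y) / s)) < b"
    proof eventually_elim
      case (elim ys)
      obtain y s where ys: "ys = (y, s)" by (cases ys)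
      have "(g (y + s *\<^sub>R v) - g y) / s < r" using elim unfolding ys by simp
      then have "ereal ((g (y + s *\<^sub>R v) - g y) / s) < ereal r" by simp
      then show ?case unfolding ys using r(2) by (simp only: prod.case)
    qed
  qed
  then show "real_of_ereal (clarke_deriv g z v) \<le> real_of_ereal (clarke_deriv g z w) + L * norm (v - w)"
    by (subst (asm) fin) simp
qed

text \<open>The substitution \<open>s \<mapsto> c s\<close> turns quotients in direction \<open>c v\<close> into \<open>c\<close> times quotients in
  direction \<open>v\<close> and preserves the filter.\<close>

lemma clarke_deriv_scaleR_le:
  fixes g :: "'a::real_normed_vector \<Rightarrow> real"
  assumes L: "L-lipschitz_on UNIV g" and c: "0 < c"
  shows "real_of_ereal (clarke_deriv g z (c *\<^sub>R v)) \<le> c * real_of_ereal (clarke_deriv g z v)"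
proof -
  let ?F = "nhds z \<times>\<^sub>F at_right (0::real)"
  have "filterlim (\<lambda>s. c * s) (at_right 0) (at_right (0::real))"
    unfolding filterlim_at
  proof
    show "\<forall>\<^sub>F s in at_right 0. c * s \<in> {0<..} \<and> c * s \<noteq> 0"
      using eventually_at_right_less[of "0::real"] by eventually_elim (use c in auto)
    show "((\<lambda>s. c * s) \<longlongrightarrow> 0) (at_right 0)"
      by (rule tendsto_eq_intros tendsto_ident_at)+ auto
  qed
  then have "filterlim (\<lambda>ys. c * snd ys) (at_right 0) ?F"
    by (rule filterlim_compose[OF _ filterlim_snd])
  then have lim: "filterlim (\<lambda>ys. (fst ys, c * snd ys)) ?F ?F"
    by (rule filterlim_Pair[OF filterlim_fst])
  have "clarke_deriv g z (c *\<^sub>R v) \<le> ereal (c * real_of_ereal (clarke_deriv g z v))"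
    unfolding clarke_deriv_def[of g z "c *\<^sub>R v"]
  proof (subst Limsup_le_iff, intro allI impI)
    fix b assume "ereal (c * real_of_ereal (clarke_deriv g z v)) < b"
    then obtain r where r: "c * real_of_ereal (clarke_deriv g z v) < r" "ereal r < b"
      using ereal_dense2[of "ereal (c * real_of_ereal (clarke_deriv g z v))" b] by auto
    then have "clarke_deriv g z v < ereal (r / c)"
      using c by (subst clarke_deriv_finite[OF L]) (simp add: field_simps)
    then have "\<forall>\<^sub>F ys in ?F. (case ys of (y, s) \<Rightarrow> ereal ((g (y + s *\<^sub>R v) - g y) / s)) < ereal (r / c)"
      unfolding clarke_deriv_def by (rule Limsup_lessD)
    from eventually_compose_filterlim[OF this lim]
    show "\<forall>\<^sub>F ys in ?F. (case ys of (y, s) \<Rightarrow> ereal ((g (y + s *\<^sub>R c *\<^sub>R v) - g y) / s)) < b"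
    proof eventually_elim
      case (elim ys)
      then have "(g (fst ys + (c * snd ys) *\<^sub>R v) - g (fst ys)) / (c * snd ys) < r / c" by simp
      then have "(g (fst ys + (c * snd ys) *\<^sub>R v) - g (fst ys)) / (c * snd ys) * c < r"
        by (rule pos_less_divide_eq[OF c, THEN iffD1])
      then have "(g (fst ys + snd ys *\<^sub>R c *\<^sub>R v) - g (fst ys)) / snd ys < r"
        using c by (simp add: mult.commute)
      then have "ereal ((g (fst ys + snd ys *\<^sub>R c *\<^sub>R v) - g (fst ys)) / snd ys) < ereal r" by simp
      then show ?case using r(2) by (simp only: case_prod_beta)
    qed
  qed
  then show ?thesis by (subst (asm) clarke_deriv_finite[OF L]) simp
qed

lemma clarke_deriv_continuous:
  fixes g :: "'a::real_normed_vector \<Rightarrow> real"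
  assumes L: "L-lipschitz_on UNIV g"
  shows "continuous_on UNIV (\<lambda>v. real_of_ereal (clarke_deriv g z v))"
proof (rule lipschitz_on_continuous_on[where L = L], rule lipschitz_onI)
  fix v w
  show "dist (real_of_ereal (clarke_deriv g z v)) (real_of_ereal (clarke_deriv g z w)) \<le> L * dist v w"
    using clarke_deriv_le_add[OF L, of z v w] clarke_deriv_le_add[OF L, of z w v]
    by (simp add: dist_norm norm_minus_commute abs_le_iff)
qed (rule lipschitz_on_nonneg[OF L])

lemma eventually_clarke_quotient_less:
  assumes y: "y \<longlonglongrightarrow> z" and s: "s \<longlonglongrightarrow> 0" "\<And>n. 0 < s n"
    and less: "clarke_deriv g z v < ereal \<beta>"
  shows "\<forall>\<^sub>F n in sequentially. (g (y n + s n *\<^sub>R v) - g (y n)) / s n < \<beta>"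
proof -
  have "filterlim s (at_right 0) sequentially"
    unfolding filterlim_at using s by (auto intro!: always_eventually simp: less_imp_neq[symmetric])
  then have lim: "filterlim (\<lambda>n. (y n, s n)) (nhds z \<times>\<^sub>F at_right 0) sequentially"
    by (rule filterlim_Pair[OF y])
  have "\<forall>\<^sub>F ys in nhds z \<times>\<^sub>F at_right 0. (case ys of (y, s) \<Rightarrow> ereal ((g (y + s *\<^sub>R v) - g y) / s)) < ereal \<beta>"
    using less unfolding clarke_deriv_def by (rule Limsup_lessD)
  from eventually_compose_filterlim[OF this lim] show ?thesis by simp
qed

section \<open>Lebesgue--Bochner spaces\<close>

lemma conjugate_exponents_cases:
  fixes p q :: ennreal
  assumes "1 \<le> p" "p < \<infinity>" "1 / p + 1 / q = 1"
  obtains "p = 1" "q = \<infinity>"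
  | P Q where "1 < P" "1 < Q" "1 / P + 1 / Q = 1" "p = ennreal P" "q = ennreal Q"
proof -
  obtain P where P: "p = ennreal P" "1 \<le> P"
    using assms(1,2) by (cases p) (auto simp: ennreal_1[symmetric] simp del: ennreal_1)
  have ip: "1 / p = ennreal (1 / P)" using P by (simp add: divide_ennreal flip: ennreal_1)
  show ?thesis
  proof (cases "q = \<infinity>")
    case True
    then have "ennreal (1 / P) = 1" using assms(3) ip by simp
    then have "p = 1" using P by (simp add: ennreal_eq_1)
    with True that(1) show ?thesis by blast
  next
    case False
    then obtain Q where Q: "q = ennreal Q" "0 \<le> Q" by (cases q) auto
    have "Q \<noteq> 0" using assms(3) Q by (auto simp: ennreal_divide_zero)
    then have iq: "1 / q = ennreal (1 / Q)" using Q by (simp add: divide_ennreal flip: ennreal_1)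
    have "ennreal (1 / P + 1 / Q) = ennreal 1"
      using assms(3) P Q unfolding ip iq by (simp add: ennreal_plus)
    then have sum: "1 / P + 1 / Q = 1" using P Q by (subst (asm) ennreal_inj) auto
    moreover have "1 / P > 0" "1 / Q > 0" using P Q \<open>Q \<noteq> 0\<close> by auto
    ultimately have "1 / P < 1" "1 / Q < 1" by linarith+
    then have "1 < P" "1 < Q" using P Q \<open>Q \<noteq> 0\<close> by (auto simp: field_simps)
    with sum P Q that(2) show ?thesis by blast
  qed
qed

lemma Lp_strongly_measurable: "u \<in> Lp M r \<Longrightarrow> strongly_measurable M u"
  by (simp add: Lp_def)

text \<open>The two functions may take values in different spaces, so this also places dual-valued functions
  bounded by \<open>k\<close> in \<open>L\<^sup>q\<close>.\<close>

lemma (in complete_measure) Lp_dominated: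
  assumes v: "v \<in> Lp M r" and u: "strongly_measurable M u"
    and c: "0 \<le> c" "AE t in M. norm (u t) \<le> c * norm (v t)"
  shows "u \<in> Lp M r"
proof (cases "r = \<infinity>")
  case True
  then obtain C where "AE t in M. norm (v t) \<le> C" using v unfolding Lp_def by auto
  with c(2) have "AE t in M. norm (u t) \<le> c * C"
    by eventually_elim (use c(1) in \<open>meson mult_left_mono order_trans\<close>)
  with True u show ?thesis unfolding Lp_def by auto
next
  case False
  have "integrable M (\<lambda>t. norm (u t) powr enn2real r)"
  proof (rule Bochner_Integration.integrable_bound)
    show "integrable M (\<lambda>t. c powr enn2real r * norm (v t) powr enn2real r)"
      using v False unfolding Lp_def by auto
    show "(\<lambda>t. norm (u t) powr enn2real r) \<in> borel_measurable M"
      using borel_measurable_norm_strong[OF u] by measurable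
    show "AE t in M. norm (norm (u t) powr enn2real r) \<le> norm (c powr enn2real r * norm (v t) powr enn2real r)"
      using c(2)
    proof eventually_elim
      case (elim t)
      then have "norm (u t) powr enn2real r \<le> (c * norm (v t)) powr enn2real r"
        by (intro powr_mono2) auto
      then show ?case using c(1) by (simp add: powr_mult)
    qed
  qed
  with False u show ?thesis unfolding Lp_def by auto
qed

lemma (in complete_measure) Lp_add:
  assumes u: "u \<in> Lp M r" and v: "v \<in> Lp M r" and r: "r < \<infinity>"
  shows "(\<lambda>t. u t + v t) \<in> Lp M r"
proof -
  have su: "strongly_measurable M u" and sv: "strongly_measurable M v"
    using u v unfolding Lp_def by auto
  have sm: "strongly_measurable M (\<lambda>t. u t + v t)"
    by (rule strongly_measurable_add[OF su sv])
  have "integrable M (\<lambda>t. norm (u t + v t) powr enn2real r)"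
  proof (rule Bochner_Integration.integrable_bound)
    show "integrable M (\<lambda>t. 2 powr enn2real r * (norm (u t) powr enn2real r + norm (v t) powr enn2real r))"
      using u v r unfolding Lp_def by auto
    show "(\<lambda>t. norm (u t + v t) powr enn2real r) \<in> borel_measurable M"
      using borel_measurable_norm_strong[OF sm] by measurable
    have "norm (u t + v t) powr enn2real r
        \<le> 2 powr enn2real r * (norm (u t) powr enn2real r + norm (v t) powr enn2real r)" for t
    proof -
      have "norm (u t + v t) \<le> 2 * max (norm (u t)) (norm (v t))"
        using norm_triangle_ineq[of "u t" "v t"] by linarith
      then have "norm (u t + v t) powr enn2real r \<le> (2 * max (norm (u t)) (norm (v t))) powr enn2real r"
        by (intro powr_mono2) auto
      also have "\<dots> = 2 powr enn2real r * max (norm (u t)) (norm (v t)) powr enn2real r"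
        by (simp add: powr_mult max_def)
      also have "\<dots> \<le> 2 powr enn2real r * (norm (u t) powr enn2real r + norm (v t) powr enn2real r)"
        by (intro mult_left_mono) (auto simp: max_def)
      finally show ?thesis .
    qed
    then show "AE t in M. norm (norm (u t + v t) powr enn2real r)
        \<le> norm (2 powr enn2real r * (norm (u t) powr enn2real r + norm (v t) powr enn2real r))"
      by (simp add: abs_mult)
  qed
  with sm r show ?thesis unfolding Lp_def by auto
qed

lemma (in complete_measure) Lp_scaleR:
  assumes u: "u \<in> Lp M r"
  shows "(\<lambda>t. c *\<^sub>R u t) \<in> Lp M r"
proof (rule Lp_dominated[OF u, of _ "\<bar>c\<bar>"])
  show "strongly_measurable M (\<lambda>t. c *\<^sub>R u t)"
    using u by (intro strongly_measurable_scaleR strongly_measurable_real) (auto simp: Lp_def)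
qed auto

lemma (in complete_measure) Lp_diff:
  assumes u: "u \<in> Lp M r" and v: "v \<in> Lp M r" and r: "r < \<infinity>"
  shows "(\<lambda>t. u t - v t) \<in> Lp M r"
  using Lp_add[OF u Lp_scaleR[OF v, of "-1"] r] by simp

lemma (in complete_measure) integrable_Lp_mult:
  fixes k :: "'a \<Rightarrow> real" and u :: "'a \<Rightarrow> 'b::real_normed_vector"
  assumes pq: "1 \<le> p" "p < \<infinity>" "1 / p + 1 / q = 1"
    and k: "k \<in> Lp M q" and u: "u \<in> Lp M p"
  shows "integrable M (\<lambda>t. k t * norm (u t))"
proof -
  have m[measurable]: "k \<in> borel_measurable M" "(\<lambda>t. norm (u t)) \<in> borel_measurable M"
    using k u by (auto simp: Lp_def intro: strongly_measurable_imp_borel borel_measurable_norm_strong)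
  from pq show ?thesis
  proof (cases rule: conjugate_exponents_cases)
    case 1
    then obtain C where C: "AE t in M. \<bar>k t\<bar> \<le> C" using k by (auto simp: Lp_def)
    have "integrable M (\<lambda>t. C * norm (u t))"
      using u 1 by (auto simp: Lp_def)
    then show ?thesis
    proof (rule Bochner_Integration.integrable_bound)
      show "AE t in M. norm (k t * norm (u t)) \<le> norm (C * norm (u t))"
        using C
      proof eventually_elim
        case (elim t)
        then have "0 \<le> C" by linarith
        with elim show ?case by (auto simp: abs_mult intro: mult_right_mono)
      qed
    qed measurable
  next
    case (2 P Q)
    have "integrable M (\<lambda>t. norm (u t) powr P / P + \<bar>k t\<bar> powr Q / Q)"
      using u k 2 by (auto simp: Lp_def)
    then show ?thesis
    proof (rule Bochner_Integration.integrable_bound)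
      show "AE t in M. norm (k t * norm (u t)) \<le> norm (norm (u t) powr P / P + \<bar>k t\<bar> powr Q / Q)"
      proof (rule AE_I2)
        fix t
        have "norm (u t) * \<bar>k t\<bar> \<le> norm (u t) powr P / P + \<bar>k t\<bar> powr Q / Q"
          by (rule Youngs_inequality) (use 2 in auto)
        then show "norm (k t * norm (u t)) \<le> norm (norm (u t) powr P / P + \<bar>k t\<bar> powr Q / Q)"
          by (simp add: abs_mult mult.commute)
      qed
    qed measurable
  qed
qed

lemma one_le_enn2real: "1 \<le> p \<Longrightarrow> p < \<infinity> \<Longrightarrow> 1 \<le> enn2real p"
  by (metis enn2real_1 enn2real_mono infinity_ennreal_def)

lemma eventually_Lp_nhds:
  "0 < e \<Longrightarrow> \<forall>\<^sub>F y in Lp_nhds M r u. y \<in> Lp M r \<and> Lp_norm M r (\<lambda>t. y t - u t) < e"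
  unfolding Lp_nhds_def
  by (rule eventually_INF1[of e]) (auto simp: eventually_principal)

text \<open>Convergence of the seminorms is convergence to zero in \<open>L\<^sup>1\<close> of the real functions
  \<open>\<parallel>y\<^sub>n\<parallel>\<^sup>p\<close>, for which subsequences converging almost everywhere are available.\<close>

lemma Lp_norm_null_sequence_AE_subseq:
  fixes y :: "nat \<Rightarrow> 't \<Rightarrow> 'a::real_normed_vector"
  assumes p: "1 \<le> p" "p < \<infinity>" and y: "\<And>n. y n \<in> Lp M p" "(\<lambda>n. Lp_norm M p (y n)) \<longlonglongrightarrow> 0"
  obtains r :: "nat \<Rightarrow> nat" where "strict_mono r" "AE t in M. (\<lambda>n. y (r n) t) \<longlonglongrightarrow> 0"
proof -
  define P where "P = enn2real p"
  have P: "1 \<le> P" unfolding P_def by (rule one_le_enn2real[OF p])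
  let ?I = "\<lambda>n. \<integral>t. norm (y n t) powr P \<partial>M"
  have norm_eq: "Lp_norm M p (y n) = ?I n powr (1 / P)" for n
    using p(2) by (simp add: Lp_norm_def P_def)
  have I: "?I n = Lp_norm M p (y n) powr P" for n
    unfolding norm_eq using P by (simp add: powr_powr)
  have "(\<lambda>n. Lp_norm M p (y n) powr P) \<longlonglongrightarrow> 0 powr P"
    using P y(2) by (intro tendsto_powr2) (auto simp: norm_eq intro!: always_eventually)
  then have "(\<lambda>n. \<integral>t. norm (norm (y n t) powr P) \<partial>M) \<longlonglongrightarrow> 0"
    using P by (simp add: I)
  moreover have "integrable M (\<lambda>t. norm (y n t) powr P)" for n
    using y(1)[of n] p(2) by (simp add: Lp_def P_def)
  ultimately obtain r :: "nat \<Rightarrow> nat" where r: "strict_mono r"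
    "AE t in M. (\<lambda>n. norm (y (r n) t) powr P) \<longlonglongrightarrow> 0"
    using tendsto_L1_AE_subseq[of M "\<lambda>n t. norm (y n t) powr P"] by blast
  from r(2) have "AE t in M. (\<lambda>n. y (r n) t) \<longlonglongrightarrow> 0"
  proof eventually_elim
    case (elim t)
    have "(\<lambda>n. (norm (y (r n) t) powr P) powr (1 / P)) \<longlonglongrightarrow> 0 powr (1 / P)"
      using P elim by (intro tendsto_powr2) (auto intro!: always_eventually)
    then show ?case using P by (simp add: powr_powr tendsto_norm_zero_iff)
  qed
  with r(1) that show ?thesis by blast
qed

section \<open>The directional derivative of the integral functional\<close>

locale lusin_lipschitz_integral = complete_measure M + sigma_finite_measure M
  for M :: "'t::metric_space measure" +
  fixes f :: "'t \<Rightarrow> 'a::banach \<Rightarrow> real" and k :: "'t \<Rightarrow> real" and p q :: ennreal and x :: "'t \<Rightarrow> 'a"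
  assumes space_UNIV: "space M = UNIV"
    and borel_sets: "sets borel \<subseteq> sets M"
    and exponents: "1 \<le> p" "p < \<infinity>" "1 / p + 1 / q = 1"
    and f_lusin: "lusin_integrand M (\<lambda>t z. ereal (f t z))"
    and k_Lq: "k \<in> Lp M q"
    and f_lipschitz: "\<And>t. (k t)-lipschitz_on UNIV (f t)"
    and f_integrable_at: "\<exists>u\<in>Lp M p. integrable M (\<lambda>t. f t (u t))"
    and x_Lp: "x \<in> Lp M p"
    and deriv_lusin: "lusin_integrand M (\<lambda>t v. clarke_deriv (f t) (x t) v)"
begin

definition D :: "'t \<Rightarrow> 'a \<Rightarrow> real" where
  "D t v = real_of_ereal (clarke_deriv (f t) (x t) v)"

lemma clarke_deriv_eq_D: "clarke_deriv (f t) (x t) v = ereal (D t v)"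
  unfolding D_def by (rule clarke_deriv_finite[OF f_lipschitz])

lemma D_bound: "\<bar>D t v\<bar> \<le> k t * norm v"
  unfolding D_def by (rule clarke_deriv_bound[OF f_lipschitz])

lemma D_le_add: "D t v \<le> D t w + k t * norm (v - w)"
  unfolding D_def by (rule clarke_deriv_le_add[OF f_lipschitz])

lemma D_lusin: "lusin_integrand M (\<lambda>t v. ereal (D t v))"
  using deriv_lusin by (simp add: clarke_deriv_eq_D)

lemma k_nonneg: "0 \<le> k t"
  by (rule lipschitz_on_nonneg[OF f_lipschitz])

lemma k_measurable[measurable]: "k \<in> borel_measurable M"
  using k_Lq by (auto simp: Lp_def intro: strongly_measurable_imp_borel)

lemma measurable_f: "strongly_measurable M u \<Longrightarrow> (\<lambda>t. f t (u t)) \<in> borel_measurable M"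
  by (rule lusin_integrand_superposition_measurable[OF complete_measure_axioms
      sigma_finite_measure_axioms space_UNIV borel_sets f_lusin])
     (rule lipschitz_on_continuous_on[OF f_lipschitz])

lemma measurable_D: "strongly_measurable M u \<Longrightarrow> (\<lambda>t. D t (u t)) \<in> borel_measurable M"
  by (rule lusin_integrand_superposition_measurable[OF complete_measure_axioms
      sigma_finite_measure_axioms space_UNIV borel_sets D_lusin])
     (use clarke_deriv_continuous[OF f_lipschitz] in \<open>simp add: D_def[abs_def]\<close>)

lemma integrable_k_norm: "u \<in> Lp M p \<Longrightarrow> integrable M (\<lambda>t. k t * norm (u t))"
  by (rule integrable_Lp_mult[OF exponents k_Lq])

lemma integrable_D: "v \<in> Lp M p \<Longrightarrow> integrable M (\<lambda>t. D t (v t))"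
  by (rule Bochner_Integration.integrable_bound[OF integrable_k_norm])
     (auto intro!: measurable_D Lp_strongly_measurable simp: abs_mult k_nonneg D_bound)

lemma integrable_f:
  assumes u: "u \<in> Lp M p"
  shows "integrable M (\<lambda>t. f t (u t))"
proof -
  obtain u0 where u0: "u0 \<in> Lp M p" "integrable M (\<lambda>t. f t (u0 t))"
    using f_integrable_at by blast
  have "integrable M (\<lambda>t. f t (u t) - f t (u0 t))"
  proof (rule Bochner_Integration.integrable_bound)
    show "integrable M (\<lambda>t. k t * norm (u t - u0 t))"
      by (intro integrable_k_norm Lp_diff u u0 exponents)
    show "(\<lambda>t. f t (u t) - f t (u0 t)) \<in> borel_measurable M"
      using u u0 by (intro borel_measurable_diff measurable_f Lp_strongly_measurable)
    show "AE t in M. norm (f t (u t) - f t (u0 t)) \<le> norm (k t * norm (u t - u0 t))"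
      using lipschitz_onD[OF f_lipschitz, of "u _" "u0 _"]
      by (auto simp: dist_norm abs_mult k_nonneg)
  qed
  from Bochner_Integration.integrable_add[OF this u0(2)] show ?thesis by simp
qed

text \<open>The pointwise quotients \<open>q\<^sub>n\<close> need not converge, only their upper limit is controlled by \<open>D\<close>. But
  \<open>max q\<^sub>n D\<close> does converge to \<open>D\<close>, which reduces the reverse Fatou inequality to dominated
  convergence.\<close>

lemma Lp_clarke_deriv_le:
  assumes v: "v \<in> Lp M p"
  shows "Lp_clarke_deriv M p (int_functional M f) x v \<le> ereal (\<integral>t. D t (v t) \<partial>M)"
proof (rule ccontr)
  assume "\<not> ?thesis"
  then obtain c where c: "(\<integral>t. D t (v t) \<partial>M) < c" "ereal c < Lp_clarke_deriv M p (int_functional M f) x v"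
    using ereal_dense2 by (metis ereal_less_ereal_Ex less_ereal.simps(1) not_le)
  define Q where "Q y s t = (f t (y t + s *\<^sub>R v t) - f t (y t)) / s" for y s t
  have ys: "(\<lambda>t. y t + s *\<^sub>R v t) \<in> Lp M p" if "y \<in> Lp M p" for y s
    using that v exponents by (intro Lp_add Lp_scaleR)
  have Qint: "integrable M (Q y s)"
    and Qeq: "(int_functional M f (\<lambda>t. y t + s *\<^sub>R v t) - int_functional M f y) / s = (\<integral>t. Q y s t \<partial>M)"
    if "y \<in> Lp M p" for y s
    unfolding Q_def[abs_def] int_functional_def
    using integrable_f[OF that] integrable_f[OF ys[OF that]]
    by (simp_all add: Bochner_Integration.integral_diff)
  have freq: "\<exists>\<^sub>F ys in Lp_nhds M p x \<times>\<^sub>F at_right 0. case ys of (y, s) \<Rightarrow>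
      c < (int_functional M f (\<lambda>t. y t + s *\<^sub>R v t) - int_functional M f y) / s"
  proof (rule ccontr)
    assume "\<not> ?thesis"
    then have "\<forall>\<^sub>F ys in Lp_nhds M p x \<times>\<^sub>F at_right 0. (case ys of (y, s) \<Rightarrow>
      ereal ((int_functional M f (\<lambda>t. y t + s *\<^sub>R v t) - int_functional M f y) / s)) \<le> ereal c"
      unfolding not_frequently by eventually_elim (auto simp: not_less)
    then have "Lp_clarke_deriv M p (int_functional M f) x v \<le> ereal c"
      unfolding Lp_clarke_deriv_def by (rule Limsup_bounded)
    with c(2) show False by simp
  qed
  have "\<exists>y s. y \<in> Lp M p \<and> Lp_norm M p (\<lambda>t. y t - x t) < 1 / real (Suc n) \<and> 0 < s \<and> s < 1 / real (Suc n)
      \<and> c < (\<integral>t. Q y s t \<partial>M)" for n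
  proof -
    have ev: "\<forall>\<^sub>F y in Lp_nhds M p x. y \<in> Lp M p \<and> Lp_norm M p (\<lambda>t. y t - x t) < 1 / real (Suc n)"
      by (rule eventually_Lp_nhds) simp
    have es: "\<forall>\<^sub>F s in at_right 0. 0 < s \<and> s < 1 / real (Suc n)"
      using eventually_at_right_real[of 0 "1 / real (Suc n)"] by (simp add: eventually_mono)
    from eventually_conj[OF eventually_compose_filterlim[OF ev filterlim_fst]
        eventually_compose_filterlim[OF es filterlim_snd]]
    have "\<forall>\<^sub>F ys in Lp_nhds M p x \<times>\<^sub>F at_right 0.
        (fst ys \<in> Lp M p \<and> Lp_norm M p (\<lambda>t. fst ys t - x t) < 1 / real (Suc n)) \<and>
        (0 < snd ys \<and> snd ys < 1 / real (Suc n))" .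
    from frequently_ex[OF frequently_eventually_conj[OF freq this]]
    show ?thesis using Qeq by fastforce
  qed
  then obtain y s where y: "\<And>n. y n \<in> Lp M p" "\<And>n. Lp_norm M p (\<lambda>t. y n t - x t) < 1 / real (Suc n)"
    and s: "\<And>n. 0 < s n" "\<And>n. s n < 1 / real (Suc n)" and cQ: "\<And>n. c < (\<integral>t. Q (y n) (s n) t \<partial>M)"
    by metis
  have inv: "(\<lambda>n. 1 / real (Suc n)) \<longlonglongrightarrow> 0"
    using LIMSEQ_inverse_real_of_nat by (simp add: inverse_eq_divide)
  have s0: "s \<longlonglongrightarrow> 0"
    by (rule real_tendsto_sandwich[OF _ _ tendsto_const inv]) (use s in \<open>auto intro!: always_eventually less_imp_le\<close>)
  have y0: "(\<lambda>n. Lp_norm M p (\<lambda>t. y n t - x t)) \<longlonglongrightarrow> 0"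
    by (rule real_tendsto_sandwich[OF _ _ tendsto_const inv])
       (use y(2) exponents(2) in \<open>auto intro!: always_eventually less_imp_le simp: Lp_norm_def\<close>)
  obtain r :: "nat \<Rightarrow> nat" where r: "strict_mono r" "AE t in M. (\<lambda>n. y (r n) t - x t) \<longlonglongrightarrow> 0"
    using Lp_norm_null_sequence_AE_subseq[OF exponents(1,2), of "\<lambda>n t. y n t - x t" M] y0
      Lp_diff[OF y(1) x_Lp exponents(2)] by blast
  have sr: "(\<lambda>n. s (r n)) \<longlonglongrightarrow> 0" using LIMSEQ_subseq_LIMSEQ[OF s0 r(1)] by (simp add: o_def)
  let ?q = "\<lambda>n t. Q (y (r n)) (s (r n)) t"
  have Qbound: "\<bar>?q n t\<bar> \<le> k t * norm (v t)" for n t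
    unfolding Q_def by (rule lipschitz_quotient_le(2)[OF f_lipschitz s(1)])
  have "(\<lambda>n. \<integral>t. max (?q n t) (D t (v t)) \<partial>M) \<longlonglongrightarrow> (\<integral>t. D t (v t) \<partial>M)"
  proof (rule integral_dominated_convergence[where w = "\<lambda>t. k t * norm (v t)"])
    show "AE t in M. (\<lambda>n. max (?q n t) (D t (v t))) \<longlonglongrightarrow> D t (v t)"
      using r(2)
    proof eventually_elim
      case (elim t)
      have yt: "(\<lambda>n. y (r n) t) \<longlonglongrightarrow> x t" using elim by (rule LIM_zero_cancel)
      show ?case
      proof (rule order_tendstoI)
        fix a assume "D t (v t) < a"
        then have "\<forall>\<^sub>F n in sequentially. ?q n t < a"
          unfolding Q_def
          by (intro eventually_clarke_quotient_less[OF yt sr s(1)]) (simp add: clarke_deriv_eq_D)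
        then show "\<forall>\<^sub>F n in sequentially. max (?q n t) (D t (v t)) < a"
          by eventually_elim (use \<open>D t (v t) < a\<close> in simp)
      qed (auto intro: always_eventually simp: less_max_iff_disj)
    qed
    show "AE t in M. norm (max (?q n t) (D t (v t))) \<le> k t * norm (v t)" for n
    proof (rule AE_I2)
      fix t
      show "norm (max (?q n t) (D t (v t))) \<le> k t * norm (v t)"
        using Qbound[of n t] D_bound[of t "v t"] by (simp add: max_def)
    qed
  qed (use integrable_D[OF v] Qint[OF y(1)] integrable_k_norm[OF v] in auto)
  moreover have "c \<le> (\<integral>t. max (?q n t) (D t (v t)) \<partial>M)" for n
  proof -
    have "(\<integral>t. ?q n t \<partial>M) \<le> (\<integral>t. max (?q n t) (D t (v t)) \<partial>M)"
      using integrable_D[OF v] Qint[OF y(1)] by (intro integral_mono integrable_max) auto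
    with cQ[of "r n"] show ?thesis by linarith
  qed
  ultimately have "c \<le> (\<integral>t. D t (v t) \<partial>M)" by (meson LIMSEQ_le_const)
  with c(1) show False by simp
qed

end

section \<open>Densities with values in the dual of an Asplund space\<close>

text \<open>A sublinear function bounded above by the norm is 1-Lipschitz, and a set whose closure is the
  whole space is nonempty.\<close>

lemma asplund_sublinear_differentiable:
  fixes g :: "'a::banach \<Rightarrow> real"
  assumes A: "asplund TYPE('a)"
    and sub: "\<And>y z. g (y + z) \<le> g y + g z" and hom: "\<And>c z. 0 < c \<Longrightarrow> g (c *\<^sub>R z) \<le> c * g z"
    and bound: "\<And>z. g z \<le> norm z"
  obtains z where "g differentiable (at z)"
proof -
  have "convex_on UNIV g"
  proof (rule convex_onI)
    fix c :: real and y z :: 'a assume "0 < c" "c < 1"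
    then have "g ((1 - c) *\<^sub>R y) \<le> (1 - c) * g y" "g (c *\<^sub>R z) \<le> c * g z" using hom by auto
    with sub[of "(1 - c) *\<^sub>R y" "c *\<^sub>R z"] show "g ((1 - c) *\<^sub>R y + c *\<^sub>R z) \<le> (1 - c) * g y + c * g z"
      by linarith
  qed simp
  moreover have "1-lipschitz_on UNIV g"
  proof (rule lipschitz_onI)
    fix y z
    show "dist (g y) (g z) \<le> 1 * dist y z"
      using sub[of "y - z" z] sub[of "z - y" y] bound[of "y - z"] bound[of "z - y"]
      by (simp add: dist_norm norm_minus_commute abs_le_iff)
  qed simp
  then have "continuous_on UNIV g" by (rule lipschitz_on_continuous_on)
  ultimately obtain E where "UNIV \<subseteq> closure E" "\<forall>z\<in>E. g differentiable (at z)"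
    using A unfolding asplund_def by (metis convex_UNIV open_UNIV)
  then show ?thesis using that by (metis UNIV_I closure_empty ex_in_conv subset_empty empty_not_UNIV)
qed

text \<open>This is the measurable counterpart of the fact that bounded sets in the dual of an Asplund space have
  weak-star slices of small diameter: \<open>F\<close> is the part of \<open>E\<close> that \<open>u\<close> maps into a slice of its essential
  range, and \<open>a\<close> is the derivative of the essential support function \<open>\<sigma>\<close>.\<close>

lemma asplund_small_oscillation_piece:
  fixes u :: "'a::banach \<Rightarrow> 't \<Rightarrow> real"
  assumes A: "asplund TYPE('a)"
    and m[measurable]: "\<And>z. u z \<in> borel_measurable M"
    and bound: "\<And>z. AE t in M. \<bar>u z t\<bar> \<le> norm z"
    and add: "\<And>y z. AE t in M. u (y + z) t = u y t + u z t"
    and hom: "\<And>c z. AE t in M. u (c *\<^sub>R z) t = c * u z t"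
    and E[measurable]: "E \<in> sets M" and pos: "emeasure M E > 0" and e: "\<epsilon> > 0"
  obtains F and a :: "'a \<Rightarrow>\<^sub>L real" where "F \<subseteq> E" "F \<in> sets M" "emeasure M F > 0"
    "\<forall>z. AE t in M. t \<in> F \<longrightarrow> \<bar>u z t - a z\<bar> \<le> \<epsilon> * norm z"
proof -
  have notnull: "\<not> (AE t in M. t \<notin> E)"
    using pos by (metis E AE_iff_null_sets less_irrefl null_setsD1)
  define S where "S z = {c. AE t in M. t \<in> E \<longrightarrow> u z t \<le> c}" for z
  define \<sigma> where "\<sigma> z = Inf (S z)" for z
  have norm_S: "norm z \<in> S z" for z
    using bound[of z] unfolding S_def by (auto elim: eventually_mono)
  have S_ge: "- norm z \<le> c" if "c \<in> S z" for c z
  proof (rule ccontr)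
    assume "\<not> - norm z \<le> c"
    moreover have "AE t in M. t \<in> E \<longrightarrow> u z t \<le> c" using that unfolding S_def by auto
    ultimately have "AE t in M. t \<notin> E" using bound[of z] by (auto elim: eventually_elim2)
    with notnull show False by blast
  qed
  then have bdd: "bdd_below (S z)" for z by (meson bdd_belowI)
  have lower: "\<sigma> z \<le> c" if "c \<in> S z" for c z unfolding \<sigma>_def by (rule cInf_lower[OF that bdd])
  have \<sigma>_S: "AE t in M. t \<in> E \<longrightarrow> u z t \<le> \<sigma> z" for z
  proof -
    have "AE t in M. t \<in> E \<longrightarrow> u z t \<le> \<sigma> z + 1 / real (Suc n)" for n
    proof -
      have "Inf (S z) < \<sigma> z + 1 / real (Suc n)" unfolding \<sigma>_def by simp
      then obtain c where "c \<in> S z" "c < \<sigma> z + 1 / real (Suc n)"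
        using cInf_lessD norm_S by (metis empty_iff)
      then show ?thesis unfolding S_def by (auto elim: eventually_mono)
    qed
    then have "AE t in M. \<forall>n. t \<in> E \<longrightarrow> u z t \<le> \<sigma> z + 1 / real (Suc n)"
      by (subst AE_all_countable) blast
    then show ?thesis
    proof eventually_elim
      case (elim t)
      show ?case
      proof (rule impI, rule field_le_epsilon)
        fix d :: real assume "t \<in> E" "0 < d"
        obtain n where n: "1 / real (Suc n) < d" using \<open>0 < d\<close> by (rule nat_approx_posE)
        have "u z t \<le> \<sigma> z + 1 / real (Suc n)" using elim \<open>t \<in> E\<close> by blast
        with n show "u z t \<le> \<sigma> z + d" by linarith
      qed
    qed
  qed
  obtain z0 where "\<sigma> differentiable (at z0)"
  proof (rule asplund_sublinear_differentiable[OF A, of \<sigma>])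
    fix y z
    have "\<sigma> y + \<sigma> z \<in> S (y + z)" unfolding S_def mem_Collect_eq
      using \<sigma>_S[of y] \<sigma>_S[of z] add[of y z] by eventually_elim auto
    then show "\<sigma> (y + z) \<le> \<sigma> y + \<sigma> z" by (rule lower)
  next
    fix c :: real and z assume c: "0 < c"
    have "c * \<sigma> z \<in> S (c *\<^sub>R z)" unfolding S_def mem_Collect_eq
      using \<sigma>_S[of z] hom[of c z] by eventually_elim (use c in auto)
    then show "\<sigma> (c *\<^sub>R z) \<le> c * \<sigma> z" by (rule lower)
  next
    show "\<sigma> z \<le> norm z" for z by (rule lower[OF norm_S])
  qed
  then obtain L where L: "(\<sigma> has_derivative L) (at z0)" unfolding differentiable_def by blast
  have bl: "bounded_linear L" using L by (rule has_derivative_bounded_linear)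
  define a where "a = Blinfun L"
  have a: "blinfun_apply a z = L z" for z unfolding a_def by (simp add: bounded_linear_Blinfun_apply[OF bl])
  obtain d where d: "d > 0" "\<And>y. norm (y - z0) < d \<Longrightarrow> norm (\<sigma> y - \<sigma> z0 - L (y - z0)) \<le> \<epsilon> / 2 * norm (y - z0)"
    using L e unfolding has_derivative_at_alt by (metis half_gt_zero)
  define F where "F = {t\<in>space M. t \<in> E \<and> \<sigma> z0 - \<epsilon> / 2 * (d / 2) < u z0 t}"
  have sF: "F \<in> sets M" unfolding F_def by measurable
  have "emeasure M F \<noteq> 0"
  proof
    assume "emeasure M F = 0"
    then have "AE t in M. t \<notin> F" using sF by (intro AE_not_in) auto
    then have "\<sigma> z0 - \<epsilon> / 2 * (d / 2) \<in> S z0" unfolding S_def mem_Collect_eq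
      using AE_space by eventually_elim (auto simp: F_def)
    from lower[OF this] mult_pos_pos[OF e d(1)] show False by simp
  qed
  have up: "AE t in M. t \<in> F \<longrightarrow> u z t \<le> a z + \<epsilon> * norm z" for z
  proof (cases "z = 0")
    case True
    then show ?thesis using bound[of 0] by (auto elim: eventually_mono)
  next
    case False
    \<comment> \<open>The depth of the slice is tied to the scale \<open>d / 2\<close>, so every direction is rescaled to that norm.\<close>
    define c where "c = d / 2 / norm z"
    have c: "c > 0" "norm (c *\<^sub>R z) = d / 2" using False d(1) unfolding c_def by auto
    have "\<bar>\<sigma> (z0 + c *\<^sub>R z) - \<sigma> z0 - L (c *\<^sub>R z)\<bar> \<le> \<epsilon> / 2 * (d / 2)"
      using d(2)[of "z0 + c *\<^sub>R z", unfolded add_diff_cancel_left' c(2) real_norm_def] d(1) by linarith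
    then have "\<sigma> (z0 + c *\<^sub>R z) \<le> \<sigma> z0 + L (c *\<^sub>R z) + \<epsilon> / 2 * (d / 2)" by linarith
    moreover have "L (c *\<^sub>R z) = c * L z" using bl by (simp add: bounded_linear.linear linear_scale)
    moreover have "c * norm z = d / 2" using c by simp
    then have cn: "c * (L z + \<epsilon> * norm z) = c * L z + \<epsilon> * (d / 2)"
      by (simp add: distrib_left mult.left_commute)
    ultimately have key: "\<sigma> (z0 + c *\<^sub>R z) - \<sigma> z0 + \<epsilon> / 2 * (d / 2) \<le> c * (L z + \<epsilon> * norm z)"
      using cn by linarith
    show ?thesis
      using \<sigma>_S[of "z0 + c *\<^sub>R z"] add[of z0 "c *\<^sub>R z"] hom[of c z]
    proof eventually_elim
      case (elim t)
      show ?case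
      proof
        assume t: "t \<in> F"
        then have "c * u z t \<le> \<sigma> (z0 + c *\<^sub>R z) - \<sigma> z0 + \<epsilon> / 2 * (d / 2)"
          using elim unfolding F_def by auto
        with key have "c * u z t \<le> c * (L z + \<epsilon> * norm z)" by linarith
        then show "u z t \<le> a z + \<epsilon> * norm z" using c(1) by (simp add: a)
      qed
    qed
  qed
  \<comment> \<open>The lower bound is the upper bound in the opposite direction.\<close>
  have "AE t in M. t \<in> F \<longrightarrow> \<bar>u z t - a z\<bar> \<le> \<epsilon> * norm z" for z
    using up[of z] up[of "- z"] hom[of "-1" z]
    by eventually_elim (auto simp: abs_le_iff blinfun.minus_right)
  moreover have "F \<subseteq> E" unfolding F_def by auto
  ultimately show ?thesis using that sF \<open>emeasure M F \<noteq> 0\<close> by (auto simp: zero_less_iff_neq_zero)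
qed

lemma simple_function_first_hit:
  fixes F :: "nat \<Rightarrow> 't set"
  assumes F: "\<And>i. F i \<in> sets M" and "simple_function M r"
  shows "simple_function M (\<lambda>t. if \<exists>i\<le>n. t \<in> F i then a (LEAST i. t \<in> F i) else r t)"
  using assms(2)
proof (induction n arbitrary: r)
  case 0
  have "(\<lambda>t. if \<exists>i\<le>0. t \<in> F i then a (LEAST i. t \<in> F i) else r t) = (\<lambda>t. if t \<in> F 0 then a 0 else r t)"
    by (auto simp: fun_eq_iff intro: Least_equality)
  then show ?case using 0 F by (auto intro!: simple_function_If)
next
  case (Suc n)
  have "(\<lambda>t. if \<exists>i\<le>Suc n. t \<in> F i then a (LEAST i. t \<in> F i) else r t) =
      (\<lambda>t. if \<exists>i\<le>n. t \<in> F i then a (LEAST i. t \<in> F i) else if t \<in> F (Suc n) then a (Suc n) else r t)"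
  proof
    fix t
    show "(if \<exists>i\<le>Suc n. t \<in> F i then a (LEAST i. t \<in> F i) else r t) =
      (if \<exists>i\<le>n. t \<in> F i then a (LEAST i. t \<in> F i) else if t \<in> F (Suc n) then a (Suc n) else r t)"
    proof (cases "\<exists>i\<le>n. t \<in> F i")
      case False
      then have "(LEAST i. t \<in> F i) = Suc n" if "t \<in> F (Suc n)"
        using that by (intro Least_equality) (auto simp: not_less_eq_eq[symmetric])
      with False show ?thesis by (auto simp: le_Suc_eq)
    qed (auto intro: le_SucI)
  qed
  moreover have "simple_function M (\<lambda>t. if t \<in> F (Suc n) then a (Suc n) else r t)"
    using Suc.prems F by (intro simple_function_If) auto
  ultimately show ?case using Suc.IH by simp
qed

text \<open>The sets \<open>F j i\<close> form the \<open>j\<close>-th of a sequence of countable covers, and \<open>a j i\<close> is the value to be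
  taken on \<open>F j i\<close>. The function consults only the first \<open>n + 1\<close> sets of each of the first \<open>m\<close> covers and
  uses the finest of these covers that reaches the point. Truncating each cover makes it simple; falling
  back to coarser covers makes it converge at every covered point, with no estimate of the measure
  left over by the truncation.\<close>

primrec finest_hit :: "(nat \<Rightarrow> nat \<Rightarrow> 't set) \<Rightarrow> (nat \<Rightarrow> nat \<Rightarrow> 'b::zero) \<Rightarrow> nat \<Rightarrow> nat \<Rightarrow> 't \<Rightarrow> 'b" where
  "finest_hit F a n 0 t = 0"
| "finest_hit F a n (Suc m) t =
    (if \<exists>i\<le>n. t \<in> F m i then a m (LEAST i. t \<in> F m i) else finest_hit F a n m t)"

lemma simple_function_finest_hit:
  assumes "\<And>m i. F m i \<in> sets M"
  shows "simple_function M (finest_hit F a n m)"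
proof (induction m)
  case (Suc m)
  then show ?case using simple_function_first_hit[of "F m", OF assms Suc] by simp
qed simp

lemma finest_hit_eq:
  assumes "m < m'" "i \<le> n" "t \<in> F m i"
  obtains j where "m \<le> j" "\<exists>i. t \<in> F j i" "finest_hit F a n m' t = a j (LEAST i. t \<in> F j i)"
  using assms
proof (induction m' arbitrary: thesis)
  case (Suc m')
  show ?case
  proof (cases "\<exists>i\<le>n. t \<in> F m' i")
    case True
    then show ?thesis using Suc.prems by (intro Suc.prems(1)[of m']) auto
  next
    case False
    then have "m \<noteq> m'" using Suc.prems by auto
    then show ?thesis using Suc False by auto
  qed
qed simp

text \<open>The values that cover \<open>m\<close> assigns to a point form a Cauchy sequence in \<open>m\<close> by the
  compatibility of overlapping pieces.\<close>

lemma strongly_measurable_from_pieces: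
  fixes a :: "nat \<Rightarrow> nat \<Rightarrow> 'b::banach"
  assumes F: "\<And>m i. F m i \<in> sets M"
    and cov: "AE t in M. \<forall>m. \<exists>i. t \<in> F m i"
    and cmp: "AE t in M. \<forall>m i n j. t \<in> F m i \<longrightarrow> t \<in> F n j \<longrightarrow>
        norm (a m i - a n j) \<le> 1 / real (Suc m) + 1 / real (Suc n)"
  obtains \<xi> where "strongly_measurable M \<xi>"
    "AE t in M. \<forall>m i. t \<in> F m i \<longrightarrow> norm (\<xi> t - a m i) \<le> 1 / real (Suc m)"
proof -
  define b where "b m t = a m (LEAST i. t \<in> F m i)" for m t
  define \<xi> where "\<xi> t = lim (\<lambda>m. b m t)" for t
  have inv: "(\<lambda>n. 1 / real (Suc n)) \<longlonglongrightarrow> 0"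
    using LIMSEQ_inverse_real_of_nat by (simp add: inverse_eq_divide)
  have close: "AE t in M. \<forall>m i. t \<in> F m i \<longrightarrow> norm (\<xi> t - a m i) \<le> 1 / real (Suc m)"
    using cov cmp
  proof eventually_elim
    case (elim t)
    have hit: "t \<in> F m (LEAST i. t \<in> F m i)" for m using elim(1) by (meson LeastI_ex)
    have bb: "norm (b m t - b n t) \<le> 1 / real (Suc m) + 1 / real (Suc n)" for m n
      unfolding b_def using elim(2) hit by blast
    have "Cauchy (\<lambda>m. b m t)"
    proof (rule metric_CauchyI)
      fix d :: real assume "0 < d"
      then have "0 < d / 2" by simp
      then obtain N where N: "1 / real (Suc N) < d / 2" using nat_approx_posE by blast
      have "dist (b m t) (b n t) < d" if "N \<le> m" "N \<le> n" for m n
      proof -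
        have "1 / real (Suc m) \<le> 1 / real (Suc N)" "1 / real (Suc n) \<le> 1 / real (Suc N)"
          using that by (auto intro!: divide_left_mono)
        then show ?thesis using bb[of m n] N unfolding dist_norm by linarith
      qed
      then show "\<exists>N. \<forall>m\<ge>N. \<forall>n\<ge>N. dist (b m t) (b n t) < d" by blast
    qed
    then have lim: "(\<lambda>n. b n t) \<longlonglongrightarrow> \<xi> t"
      unfolding \<xi>_def by (simp add: Cauchy_convergent_iff convergent_LIMSEQ_iff)
    show ?case
    proof (intro allI impI)
      fix m i assume ti: "t \<in> F m i"
      have "(\<lambda>n. norm (b n t - a m i)) \<longlonglongrightarrow> norm (\<xi> t - a m i)"
        by (intro tendsto_intros lim)
      moreover have "(\<lambda>n. 1 / real (Suc n) + 1 / real (Suc m)) \<longlonglongrightarrow> 0 + 1 / real (Suc m)"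
        by (intro tendsto_add inv tendsto_const)
      moreover have "norm (b n t - a m i) \<le> 1 / real (Suc n) + 1 / real (Suc m)" for n
        unfolding b_def using elim(2) hit ti by blast
      ultimately show "norm (\<xi> t - a m i) \<le> 1 / real (Suc m)"
        using LIMSEQ_le[of "\<lambda>n. norm (b n t - a m i)" _ "\<lambda>n. 1 / real (Suc n) + 1 / real (Suc m)" "0 + 1 / real (Suc m)"]
        by simp
    qed
  qed
  have "AE t in M. (\<lambda>n. finest_hit F a n n t) \<longlonglongrightarrow> \<xi> t"
    using cov close
  proof eventually_elim
    case (elim t)
    show ?case
    proof (rule LIMSEQ_I)
      fix d :: real assume "0 < d"
      then obtain m where m: "1 / real (Suc m) < d" using nat_approx_posE by blast
      obtain i where i: "t \<in> F m i" using elim(1) by blast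
      have "norm (finest_hit F a n n t - \<xi> t) < d" if n: "n \<ge> max (Suc m) i" for n
      proof -
        obtain j where j: "m \<le> j" "\<exists>i. t \<in> F j i" "finest_hit F a n n t = a j (LEAST i. t \<in> F j i)"
          using n i by (elim finest_hit_eq[of m n i n t F a, rotated 3]) auto
        have "norm (\<xi> t - a j (LEAST i. t \<in> F j i)) \<le> 1 / real (Suc j)"
          using elim(2) LeastI_ex[OF j(2)] by blast
        also have "\<dots> \<le> 1 / real (Suc m)" using j(1) by (auto intro!: divide_left_mono)
        finally show ?thesis using m j(3) by (simp add: norm_minus_commute)
      qed
      then show "\<exists>N. \<forall>n\<ge>N. norm (finest_hit F a n n t - \<xi> t) < d" by blast
    qed
  qed
  then have "strongly_measurable M \<xi>"
    unfolding strongly_measurable_def using simple_function_finest_hit[of F M a, OF F]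
    by (intro exI[of _ "\<lambda>n. finest_hit F a n n"]) auto
  with close that show ?thesis by blast
qed

text \<open>Pieces on which \<open>u\<close> is within \<open>1 / (n + 1)\<close> of a fixed functional cover almost everything, for
  each \<open>n\<close>. On overlapping pieces of positive common measure the two functionals can be compared through
  \<open>u\<close>; there are only countably many other overlaps, all null.\<close>

lemma asplund_dual_density:
  fixes u :: "'a::banach \<Rightarrow> 't \<Rightarrow> real"
  assumes A: "asplund TYPE('a)" and sf: "sigma_finite_measure M"
    and m[measurable]: "\<And>z. u z \<in> borel_measurable M"
    and bound: "\<And>z. AE t in M. \<bar>u z t\<bar> \<le> norm z"
    and add: "\<And>y z. AE t in M. u (y + z) t = u y t + u z t"
    and hom: "\<And>c z. AE t in M. u (c *\<^sub>R z) t = c * u z t"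
  obtains \<eta> :: "'t \<Rightarrow> 'a \<Rightarrow>\<^sub>L real" where "strongly_measurable M \<eta>"
    "\<And>z. AE t in M. \<eta> t z = u z t"
proof -
  interpret sigma_finite_measure M by fact
  define good where "good n F \<longleftrightarrow> (\<exists>a :: 'a \<Rightarrow>\<^sub>L real. \<forall>z. AE t in M. t \<in> F \<longrightarrow>
      \<bar>u z t - a z\<bar> \<le> 1 / real (Suc n) * norm z)" for n F
  have "\<exists>F :: nat \<Rightarrow> 't set. (\<forall>i. F i \<in> sets M) \<and> (\<forall>i. good n (F i)) \<and> (AE t in M. \<exists>i. t \<in> F i)" for n
  proof (rule countable_cover_by_exhaustion[of "good n"])
    fix E assume E: "E \<in> sets M" "emeasure M E > 0"
    have "0 < 1 / real (Suc n)" by simp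
    from asplund_small_oscillation_piece[OF A m bound add hom E this]
    obtain F and a :: "'a \<Rightarrow>\<^sub>L real" where F: "F \<subseteq> E" "F \<in> sets M" "0 < emeasure M F"
      and a: "\<forall>z. AE t in M. t \<in> F \<longrightarrow> \<bar>u z t - a z\<bar> \<le> 1 / real (Suc n) * norm z" .
    from a have "good n F" unfolding good_def by (intro exI[of _ a])
    with F show "\<exists>F\<subseteq>E. F \<in> sets M \<and> 0 < emeasure M F \<and> good n F" by blast
  qed (auto simp: good_def)
  then have "\<exists>F :: nat \<Rightarrow> nat \<Rightarrow> 't set. \<forall>n. (\<forall>i. F n i \<in> sets M) \<and> (\<forall>i. good n (F n i)) \<and>
      (AE t in M. \<exists>i. t \<in> F n i)"
    by (intro choice allI)
  then obtain F :: "nat \<Rightarrow> nat \<Rightarrow> 't set" where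
    F: "\<And>n i. F n i \<in> sets M" "\<And>n i. good n (F n i)" "\<And>n. AE t in M. \<exists>i. t \<in> F n i"
    by blast
  have "\<forall>n. \<exists>a. \<forall>i z. AE t in M. t \<in> F n i \<longrightarrow> \<bar>u z t - blinfun_apply (a i) z\<bar> \<le> 1 / real (Suc n) * norm z"
    using F(2) unfolding good_def by (intro allI choice) blast
  then have "\<exists>a. \<forall>n i z. AE t in M. t \<in> F n i \<longrightarrow> \<bar>u z t - blinfun_apply (a n i) z\<bar> \<le> 1 / real (Suc n) * norm z"
    by (rule choice)
  then obtain a :: "nat \<Rightarrow> nat \<Rightarrow> 'a \<Rightarrow>\<^sub>L real" where
    a: "\<And>n i z. AE t in M. t \<in> F n i \<longrightarrow> \<bar>u z t - a n i z\<bar> \<le> 1 / real (Suc n) * norm z"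
    by blast
  have cmp: "AE t in M. t \<in> F m i \<longrightarrow> t \<in> F n j \<longrightarrow>
      norm (a m i - a n j) \<le> 1 / real (Suc m) + 1 / real (Suc n)" for m i n j
  proof (cases "AE t in M. \<not> (t \<in> F m i \<and> t \<in> F n j)")
    case True
    then show ?thesis by eventually_elim auto
  next
    case False
    have "norm (a m i - a n j) \<le> 1 / real (Suc m) + 1 / real (Suc n)"
    proof (rule norm_blinfun_bound)
      fix z
      show "norm ((a m i - a n j) z) \<le> (1 / real (Suc m) + 1 / real (Suc n)) * norm z"
      proof (rule ccontr)
        assume "\<not> ?thesis"
        then have big: "(1 / real (Suc m) + 1 / real (Suc n)) * norm z < \<bar>a m i z - a n j z\<bar>"
          by (simp add: blinfun.diff_left)
        have "AE t in M. \<not> (t \<in> F m i \<and> t \<in> F n j)"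
          using a[where n=m and i=i and z=z] a[where n=n and i=j and z=z]
          by eventually_elim (use big in \<open>auto simp: distrib_right simp del: of_nat_Suc\<close>)
        with False show False by blast
      qed
    qed simp
    then show ?thesis by simp
  qed
  obtain \<eta> where \<eta>: "strongly_measurable M \<eta>"
    "AE t in M. \<forall>m i. t \<in> F m i \<longrightarrow> norm (\<eta> t - a m i) \<le> 1 / real (Suc m)"
  proof (rule strongly_measurable_from_pieces[of F M a])
    show "AE t in M. \<forall>m. \<exists>i. t \<in> F m i" using F(3) by (simp add: AE_all_countable)
    show "AE t in M. \<forall>m i n j. t \<in> F m i \<longrightarrow> t \<in> F n j \<longrightarrow>
        norm (a m i - a n j) \<le> 1 / real (Suc m) + 1 / real (Suc n)"
      using cmp unfolding AE_all_countable by blast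
  qed (use F in auto)
  have "AE t in M. \<eta> t z = u z t" for z
  proof -
    have "AE t in M. \<forall>n i. t \<in> F n i \<longrightarrow> \<bar>u z t - a n i z\<bar> \<le> 1 / real (Suc n) * norm z"
      using a unfolding AE_all_countable by blast
    moreover have "AE t in M. \<forall>n. \<exists>i. t \<in> F n i" using F(3) by (simp add: AE_all_countable)
    ultimately show ?thesis using \<eta>(2)
    proof eventually_elim
      case (elim t)
      have "\<bar>\<eta> t z - u z t\<bar> \<le> 1 / real (Suc n) * (2 * norm z)" for n
      proof -
        obtain i where i: "t \<in> F n i" using elim(2) by blast
        have "\<bar>\<eta> t z - a n i z\<bar> \<le> norm (\<eta> t - a n i) * norm z"
          using norm_blinfun[of "\<eta> t - a n i" z] by (simp add: blinfun.diff_left)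
        also have "\<dots> \<le> 1 / real (Suc n) * norm z"
          using elim(3) i by (intro mult_right_mono) auto
        finally have "\<bar>\<eta> t z - a n i z\<bar> \<le> 1 / real (Suc n) * norm z" .
        moreover have "\<bar>u z t - a n i z\<bar> \<le> 1 / real (Suc n) * norm z" using elim(1) i by blast
        moreover have "1 / real (Suc n) * (2 * norm z) = 2 * (1 / real (Suc n) * norm z)" by simp
        ultimately show ?thesis by linarith
      qed
      moreover have "(\<lambda>n. 1 / real (Suc n) * (2 * norm z)) \<longlonglongrightarrow> 0 * (2 * norm z)"
        using LIMSEQ_inverse_real_of_nat by (intro tendsto_mult tendsto_const) (simp add: inverse_eq_divide)
      ultimately have "\<bar>\<eta> t z - u z t\<bar> \<le> 0 * (2 * norm z)"
        by (meson LIMSEQ_le_const)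
      then show ?case by simp
    qed
  qed
  with \<eta>(1) that show ?thesis by blast
qed

section \<open>Set functions dominated by a measure\<close>

text \<open>Adding \<open>C\<close> times the measure makes the set function nonnegative. Domination supplies continuity at
  the empty set, which upgrades finite to countable additivity, so the Radon-Nikodym theorem for
  positive measures applies.\<close>

lemma (in finite_measure) dominated_set_function_density:
  fixes m :: "'a set \<Rightarrow> real"
  assumes add: "\<And>A B. A \<in> sets M \<Longrightarrow> B \<in> sets M \<Longrightarrow> A \<inter> B = {} \<Longrightarrow> m (A \<union> B) = m A + m B"
    and bound: "\<And>A. A \<in> sets M \<Longrightarrow> \<bar>m A\<bar> \<le> C * measure M A" and C: "0 \<le> C"
  obtains u where "u \<in> borel_measurable M" "AE t in M. \<bar>u t\<bar> \<le> C"
    "\<And>A. A \<in> sets M \<Longrightarrow> m A = (\<integral>t. indicator A t * u t \<partial>M)"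
proof -
  define \<nu> where "\<nu> A = ennreal (m A + C * measure M A)" for A
  have nonneg: "0 \<le> m A + C * measure M A" if "A \<in> sets M" for A using bound[OF that] by linarith
  have "m {} = 0" using bound[of "{}"] by simp
  then have pos: "positive (sets M) \<nu>" unfolding positive_def \<nu>_def by simp
  have "countably_additive (sets M) \<nu>"
  proof (rule sets.empty_continuous_imp_countably_additive[OF pos])
    show "additive (sets M) \<nu>"
      unfolding additive_def
    proof (intro ballI impI)
      fix A B assume AB: "A \<in> sets M" "B \<in> sets M" "A \<inter> B = {}"
      then show "\<nu> (A \<union> B) = \<nu> A + \<nu> B"
        unfolding \<nu>_def using nonneg
        by (simp add: add finite_measure_Union distrib_left ac_simps flip: ennreal_plus)
    qed
    fix A :: "nat \<Rightarrow> 'a set"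
    assume A: "range A \<subseteq> sets M" "decseq A" "(\<Inter>i. A i) = {}"
    have "(\<lambda>i. measure M (A i)) \<longlonglongrightarrow> 0"
      using finite_Lim_measure_decseq[OF A(1,2)] A(3) by simp
    then have "(\<lambda>i. 2 * C * measure M (A i)) \<longlonglongrightarrow> 2 * C * 0"
      by (intro tendsto_intros)
    then have lim: "(\<lambda>i. 2 * C * measure M (A i)) \<longlonglongrightarrow> 0" by simp
    have "(\<lambda>i. m (A i) + C * measure M (A i)) \<longlonglongrightarrow> 0"
    proof (rule real_tendsto_sandwich[OF _ _ tendsto_const lim])
      show "\<forall>\<^sub>F i in sequentially. 0 \<le> m (A i) + C * measure M (A i)"
        using A(1) nonneg by (intro always_eventually) auto
      have "m (A i) \<le> C * measure M (A i)" for i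
        using A(1) bound[of "A i"] by fastforce
      then show "\<forall>\<^sub>F i in sequentially. m (A i) + C * measure M (A i) \<le> 2 * C * measure M (A i)"
        by (intro always_eventually allI) (simp add: mult.assoc)
    qed
    from tendsto_ennrealI[OF this] show "(\<lambda>i. \<nu> (A i)) \<longlonglongrightarrow> 0" unfolding \<nu>_def by simp
  qed (simp add: \<nu>_def)
  then have ms: "measure_space (space M) (sets M) \<nu>"
    using pos sets.sigma_algebra_axioms by (simp add: measure_space_def)
  define N where "N = measure_of (space M) (sets M) \<nu>"
  have sN: "sets N = sets M" and spN: "space N = space M" unfolding N_def by auto
  have eN: "emeasure N A = \<nu> A" if "A \<in> sets M" for A
    unfolding N_def using ms that
    by (intro emeasure_measure_of_sigma) (auto simp: measure_space_def)
  interpret N: finite_measure N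
    by (rule finite_measureI) (simp add: eN spN \<nu>_def)
  have ac: "absolutely_continuous M N"
    unfolding absolutely_continuous_def
  proof
    fix A assume A: "A \<in> null_sets M"
    then have "measure M A = 0" by (simp add: measure_eq_0_null_sets)
    then have "\<nu> A = 0" using bound[of A] A by (auto simp: \<nu>_def)
    then show "A \<in> null_sets N" using A sN eN by (auto simp: null_sets_def)
  qed
  obtain d where d: "d \<in> borel_measurable M" "AE t in M. RN_deriv M N t = ennreal (d t)" "\<And>t. 0 \<le> d t"
    using real_RN_deriv[OF N.finite_measure_axioms ac sN] by metis
  have dN: "density M (\<lambda>t. ennreal (d t)) = N"
    using density_RN_deriv[OF ac sN] density_cong[OF borel_measurable_RN_deriv _ d(2)] d(1) by simp
  have nn: "(\<integral>\<^sup>+t. ennreal (indicator A t * d t) \<partial>M) = ennreal (m A + C * measure M A)" if "A \<in> sets M" for A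
  proof -
    have "(\<integral>\<^sup>+t. ennreal (indicator A t * d t) \<partial>M) = (\<integral>\<^sup>+t. ennreal (d t) * indicator A t \<partial>M)"
      by (intro nn_integral_cong) (auto split: split_indicator)
    also have "\<dots> = emeasure (density M (\<lambda>t. ennreal (d t))) A"
      using d(1) that by (simp add: emeasure_density)
    finally show ?thesis using eN[OF that] unfolding dN \<nu>_def by simp
  qed
  have int: "integrable M (\<lambda>t. indicator A t * d t)"
    and eq: "(\<integral>t. indicator A t * d t \<partial>M) = m A + C * measure M A" if "A \<in> sets M" for A
  proof -
    show "integrable M (\<lambda>t. indicator A t * d t)"
      using nn[OF that] d that by (intro integrableI_nonneg) auto
    show "(\<integral>t. indicator A t * d t \<partial>M) = m A + C * measure M A"
      using nn[OF that] d that nonneg[OF that] by (subst integral_eq_nn_integral) auto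
  qed
  define u where "u t = d t - C" for t
  have mu: "u \<in> borel_measurable M" unfolding u_def using d(1) by measurable
  have intd: "integrable M d"
    using int[OF sets.top] by (subst (asm) Bochner_Integration.integrable_cong[OF refl, of _ _ d]) auto
  then have intu: "integrable M u" unfolding u_def[abs_def] by simp
  have rep: "m A = (\<integral>t. indicator A t * u t \<partial>M)" if "A \<in> sets M" for A
  proof -
    have "(\<integral>t. indicator A t * u t \<partial>M) = (\<integral>t. indicator A t * d t - C * indicator A t \<partial>M)"
      unfolding u_def by (intro Bochner_Integration.integral_cong) (auto simp: algebra_simps)
    also have "\<dots> = (m A + C * measure M A) - C * measure M A"
      using int[OF that] that sets.sets_into_space[OF that]
      by (subst Bochner_Integration.integral_diff) (auto simp: eq Int_absorb2 emeasure_eq_measure)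
    finally show ?thesis by simp
  qed
  have "AE t in M. u t \<in> {- C..C}"
  proof (rule averaging_theorem[OF intu])
    fix A assume A: "A \<in> sets M" "0 < measure M A"
    have "set_lebesgue_integral M A u = m A"
      unfolding rep[OF A(1)] by (simp add: set_lebesgue_integral_def)
    then show "(1 / measure M A) *\<^sub>R set_lebesgue_integral M A u \<in> {- C..C}"
      using bound[OF A(1)] A(2) by (auto simp: abs_le_iff field_simps)
  qed simp
  then have "AE t in M. \<bar>u t\<bar> \<le> C" by eventually_elim auto
  with mu rep that show ?thesis by blast
qed

lemma (in sigma_finite_measure) AE_le_of_set_integrals_le:
  fixes g h :: "'a \<Rightarrow> real"
  assumes g: "integrable M g" and h: "integrable M h"
    and le: "\<And>A. A \<in> sets M \<Longrightarrow> (\<integral>t. indicator A t * g t \<partial>M) \<le> (\<integral>t. indicator A t * h t \<partial>M)"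
  shows "AE t in M. g t \<le> h t"
proof -
  have "AE t in M. 0 \<le> h t - g t"
  proof (rule density_nonneg)
    fix A assume A: "A \<in> sets M"
    have "set_lebesgue_integral M A (\<lambda>t. h t - g t) =
        (\<integral>t. indicator A t * h t \<partial>M) - (\<integral>t. indicator A t * g t \<partial>M)"
      using integrable_mult_indicator[OF A g] integrable_mult_indicator[OF A h]
      by (simp add: set_lebesgue_integral_def right_diff_distrib)
    with le[OF A] show "0 \<le> set_lebesgue_integral M A (\<lambda>t. h t - g t)" by simp
  qed (use g h in simp)
  then show ?thesis by simp
qed

lemma AE_density_pos:
  assumes "b \<in> borel_measurable M" "\<And>t. 0 < (b t :: real)"
  shows "(AE t in density M b. P t) \<longleftrightarrow> (AE t in M. P t)"
  using assms by (subst AE_density) auto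

section \<open>Inequalities in all directions simultaneously\<close>

text \<open>A compact subset of the union is covered by finitely many of the null sets, and inner
  regularity makes the rest arbitrarily small.\<close>

lemma inner_regular_locally_null:
  fixes M :: "'t::metric_space measure"
  assumes ir: "inner_regular M" and borel: "sets borel \<subseteq> sets M"
    and B: "compact B" "emeasure M B < \<infinity>"
    and null: "\<And>T. T \<in> \<T> \<Longrightarrow> open T" "\<And>T. T \<in> \<T> \<Longrightarrow> emeasure M (B \<inter> T) = 0"
  shows "emeasure M (B \<inter> \<Union>\<T>) = 0"
proof -
  let ?W = "B \<inter> \<Union>\<T>"
  have sB: "B \<in> sets M" using borel borel_closed[OF compact_imp_closed[OF B(1)]] by auto
  have open_sets: "B \<inter> T \<in> sets M" if "open T" for T
    using sB borel borel_open[OF that] by auto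
  have sW: "?W \<in> sets M" using null(1) by (intro open_sets) auto
  have "emeasure M ?W \<le> emeasure M B" using sB by (intro emeasure_mono) auto
  then have fin: "emeasure M ?W < \<infinity>" using B(2) by (rule le_less_trans)
  have "emeasure M ?W \<le> 0 + ennreal \<delta>" if "0 < \<delta>" for \<delta>
  proof -
    obtain K where K: "compact K" "K \<subseteq> ?W" "emeasure M (?W - K) < ennreal \<delta>"
      using ir sW fin \<open>0 < \<delta>\<close> unfolding inner_regular_def by blast
    obtain \<D> where D: "\<D> \<subseteq> \<T>" "finite \<D>" "K \<subseteq> \<Union>\<D>"
      using K(1,2) null(1) by (elim compactE[of K \<T>]) auto
    have "(\<Union>T\<in>\<D>. B \<inter> T) \<in> null_sets M"
      using D null open_sets by (intro null_sets_UN') (auto simp: null_sets_def countable_finite)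
    then have "emeasure M K = 0"
      using emeasure_mono[of K "\<Union>T\<in>\<D>. B \<inter> T" M] K(2) D(3) by fastforce
    moreover have sK: "K \<in> sets M" using borel borel_closed[OF compact_imp_closed[OF K(1)]] by auto
    moreover have "emeasure M ?W = emeasure M (?W - K) + emeasure M K"
      using sK sW K(2) by (subst plus_emeasure) (auto intro: arg_cong[where f = "emeasure M"])
    ultimately show ?thesis using K(3) by simp
  qed
  then have "emeasure M ?W \<le> 0" by (rule ennreal_le_epsilon)
  then show ?thesis by simp
qed

context lusin_lipschitz_integral
begin

text \<open>The exceptional null set in the hypothesis may depend on the direction \<open>z\<close>. It suffices to prove
  the inequality up to an error \<open>\<epsilon> \<parallel>z\<parallel>\<close>, and by exhaustion only on some part of positive measure of each
  given set.\<close>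

lemma AE_all_directions:
  fixes \<xi> :: "'t \<Rightarrow> 'a \<Rightarrow>\<^sub>L real"
  assumes ir: "inner_regular M" and \<xi>: "strongly_measurable M \<xi>"
    and le: "\<And>z. AE t in M. \<xi> t z \<le> D t z"
  shows "AE t in M. \<forall>z. \<xi> t z \<le> D t z"
proof -
  have approx: "AE t in M. \<forall>z. \<xi> t z \<le> D t z + \<epsilon> * norm z" if e: "0 < \<epsilon>" for \<epsilon>
  proof (rule AE_by_exhaustion)
    fix E assume E: "E \<in> sets M" "emeasure M E > 0"
    obtain s where s: "\<And>n. simple_function M (s n)" "AE t in M. (\<lambda>n. s n t) \<longlonglongrightarrow> \<xi> t"
      using \<xi> unfolding strongly_measurable_def by blast
    have ms: "(\<lambda>t. norm (\<xi> t - s n t)) \<in> borel_measurable M" for n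
      by (intro borel_measurable_norm_strong strongly_measurable_diff \<xi> strongly_measurable_simple s)
    \<comment> \<open>Countably many sets on which \<open>\<xi>\<close> is close to a constant and \<open>k\<close> is bounded cover almost everything.\<close>
    define G where "G n c j = {t. s n t = c \<and> norm (\<xi> t - s n t) \<le> \<epsilon> / 4 \<and> k t \<le> real j}" for n c and j :: nat
    have sG: "G n c j \<in> sets M" for n c j
    proof -
      have "s n -` {c} \<inter> space M \<in> sets M" using simple_functionD(2)[OF s(1)] .
      moreover have "{t\<in>space M. norm (\<xi> t - s n t) \<le> \<epsilon> / 4} \<in> sets M" using ms by measurable
      moreover have "{t\<in>space M. k t \<le> real j} \<in> sets M" by measurable
      moreover have "G n c j = (s n -` {c} \<inter> space M) \<inter> {t\<in>space M. norm (\<xi> t - s n t) \<le> \<epsilon> / 4}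
          \<inter> {t\<in>space M. k t \<le> real j}"
        unfolding G_def space_UNIV by auto
      ultimately show ?thesis by simp
    qed
    have "\<exists>n c j. emeasure M (E \<inter> G n c j) \<noteq> 0"
    proof (rule ccontr)
      assume "\<not> ?thesis"
      then have "AE t in M. t \<notin> E \<inter> G n c j" for n c j
        using E sG by (intro AE_not_in) (auto simp: null_sets_def)
      moreover have "countable (range (s n))" for n
        using simple_functionD(1)[OF s(1)[of n]] unfolding space_UNIV by (rule countable_finite)
      ultimately have "AE t in M. \<forall>n j. \<forall>c\<in>range (s n). t \<notin> E \<inter> G n c j"
        unfolding AE_all_countable by (intro allI AE_ball_countable[THEN iffD2] ballI)
      then have "AE t in M. t \<notin> E" using s(2)
      proof eventually_elim
        case (elim t)
        have "\<forall>\<^sub>F n in sequentially. dist (s n t) (\<xi> t) < \<epsilon> / 4"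
          using elim(2) e by (intro tendstoD) auto
        then obtain n where n: "dist (s n t) (\<xi> t) < \<epsilon> / 4"
          by (meson eventually_happens sequentially_bot)
        obtain j where j: "k t \<le> real j" using real_arch_simple by blast
        have "t \<in> G n (s n t) j"
          using n j unfolding G_def by (simp add: dist_norm norm_minus_commute)
        with elim(1) show ?case by auto
      qed
      then have "E \<in> null_sets M" using Measure_Space.AE_iff_null_sets[OF E(1)] by blast
      with E(2) show False by auto
    qed
    then obtain n c j where "0 < emeasure M (E \<inter> G n c j)" by (auto simp: zero_less_iff_neq_zero)
    with E(1) sG obtain A where A: "A \<subseteq> E \<inter> G n c j" "A \<in> sets M" "0 < emeasure M A" "emeasure M A < \<infinity>"
      by (elim finite_subset_positive[of "E \<inter> G n c j", rotated]) auto
    obtain B where B: "compact B" "B \<subseteq> A" "B \<in> sets M" "0 < emeasure M B"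
      "lsc_multifun_on B (\<lambda>t. epi (\<lambda>v. ereal (D t v)))"
      using lusin_positive_compact[OF D_lusin A(2-4) borel_sets] .
    have finB: "emeasure M B < \<infinity>"
      using emeasure_mono[OF B(2) A(2)] A(4) by (rule le_less_trans)
    have near: "\<bar>\<xi> t z - c z\<bar> \<le> \<epsilon> / 4 * norm z" and kj: "k t \<le> real j" if "t \<in> B" for t z
    proof -
      have t: "norm (\<xi> t - c) \<le> \<epsilon> / 4" "k t \<le> real j" using that B(2) A(1) unfolding G_def by auto
      have "\<bar>\<xi> t z - c z\<bar> \<le> norm (\<xi> t - c) * norm z"
        using norm_blinfun[of "\<xi> t - c" z] by (simp add: blinfun.diff_left)
      also have "\<dots> \<le> \<epsilon> / 4 * norm z" using t(1) by (rule mult_right_mono) simp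
      finally show "\<bar>\<xi> t z - c z\<bar> \<le> \<epsilon> / 4 * norm z" .
      show "k t \<le> real j" by (rule t(2))
    qed
    define \<T> where "\<T> = {T. open T \<and> emeasure M (B \<inter> T) = 0}"
    have W0: "emeasure M (B \<inter> \<Union>\<T>) = 0"
      by (rule inner_regular_locally_null[OF ir borel_sets B(1) finB]) (auto simp: \<T>_def)
    have good: "\<xi> t z \<le> D t z + \<epsilon> * norm z" if t: "t \<in> B" "t \<notin> \<Union>\<T>" for t z
    proof (rule ccontr)
      assume bad: "\<not> ?thesis"
      have "z \<noteq> 0" using bad D_bound[of t z] by auto
      \<comment> \<open>Of the excess \<open>\<epsilon> \<parallel>z\<parallel>\<close> a quarter is spent on each of the two replacements of \<open>\<xi>\<close> by \<open>c\<close> and back,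
        and another one, through the choice of \<open>r\<close>, on moving \<open>y\<close> to \<open>z\<close>.\<close>
      define \<beta> where "\<beta> = c z - 3 / 4 * (\<epsilon> * norm z)"
      define r where "r = \<epsilon> * norm z / (4 * (real j + 1))"
      have "0 < \<epsilon> * norm z" using e \<open>z \<noteq> 0\<close> by simp
      then have r: "0 < r" "real j * r \<le> \<epsilon> * norm z / 4"
        unfolding r_def by (auto simp: field_simps)
      let ?O = "{s\<in>B. \<exists>y\<in>ball z r. D s y < \<beta>}"
      have "openin (top_of_set B) ?O" by (rule sublevel_openin_lsc[OF B(5)]) simp
      then obtain T where T: "open T" "?O = B \<inter> T" by (auto simp: openin_open)
      have "D t z < \<beta>" using bad near[OF t(1), of z] unfolding \<beta>_def by linarith
      then have "t \<in> T" using T(2) t(1) r(1) centre_in_ball by blast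
      have O: "D s z < \<xi> s z" if s: "s \<in> ?O" for s
      proof -
        obtain y where y: "s \<in> B" "dist z y < r" "D s y < \<beta>" using s by auto
        have "k s * norm (z - y) \<le> real j * r"
          using y kj[OF y(1)] k_nonneg[of s] by (intro mult_mono) (auto simp: dist_norm)
        then show ?thesis
          using D_le_add[of s z y] y(3) r(2) near[OF y(1), of z] \<open>0 < \<epsilon> * norm z\<close> unfolding \<beta>_def
          by linarith
      qed
      have "AE s in M. s \<notin> ?O"
        using le[of z]
      proof eventually_elim
        case (elim s)
        then show ?case using O[of s] by linarith
      qed
      then have "AE s in M. s \<notin> B \<inter> T" unfolding T(2) .
      moreover have "B \<inter> T \<in> sets M" using B(3) T(1) borel_sets borel_open by auto
      ultimately have "emeasure M (B \<inter> T) = 0"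
        using Measure_Space.AE_iff_null_sets[of "B \<inter> T" M] by blast
      with T(1) \<open>t \<in> T\<close> t(2) show False unfolding \<T>_def by blast
    qed
    have "B \<inter> \<Union>\<T> \<in> null_sets M"
    proof (rule null_setsI[OF W0])
      have "open (\<Union>\<T>)" unfolding \<T>_def by auto
      then show "B \<inter> \<Union>\<T> \<in> sets M" using B(3) borel_sets borel_open by auto
    qed
    then have "AE t in M. t \<notin> B \<inter> \<Union>\<T>" by (rule AE_not_in)
    then have "AE t in M. t \<in> B \<longrightarrow> (\<forall>z. \<xi> t z \<le> D t z + \<epsilon> * norm z)"
      by eventually_elim (use good in blast)
    with A B show "\<exists>F\<subseteq>E. F \<in> sets M \<and> 0 < emeasure M F \<and>
        (AE t in M. t \<in> F \<longrightarrow> (\<forall>z. \<xi> t z \<le> D t z + \<epsilon> * norm z))"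
      by (intro exI[of _ B]) auto
  qed
  have "AE t in M. \<forall>n z. \<xi> t z \<le> D t z + 1 / real (Suc n) * norm z"
    by (subst AE_all_countable) (intro allI approx, simp)
  then show ?thesis
  proof eventually_elim
    case (elim t)
    show ?case
    proof
      fix z
      have "(\<lambda>n. D t z + 1 / real (Suc n) * norm z) \<longlonglongrightarrow> D t z + 0 * norm z"
        using LIMSEQ_inverse_real_of_nat
        by (intro tendsto_intros) (simp add: inverse_eq_divide)
      then show "\<xi> t z \<le> D t z"
        using LIMSEQ_le_const[of _ "D t z + 0 * norm z" "\<xi> t z"] elim by simp
    qed
  qed
qed

end

section \<open>Representing the Clarke subgradients\<close>

context lusin_lipschitz_integral
begin

lemma clarke_subgradient_le:
  assumes "\<phi> \<in> Lp_clarke_subdiff M p (int_functional M f) x" "v \<in> Lp M p"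
  shows "\<phi> v \<le> (\<integral>t. D t (v t) \<partial>M)"
proof -
  have "ereal (\<phi> v) \<le> Lp_clarke_deriv M p (int_functional M f) x v"
    using assms unfolding Lp_clarke_subdiff_def by blast
  also have "\<dots> \<le> ereal (\<integral>t. D t (v t) \<partial>M)" by (rule Lp_clarke_deriv_le[OF assms(2)])
  finally show ?thesis by simp
qed

lemma clarke_subgradient_linear:
  assumes "\<phi> \<in> Lp_clarke_subdiff M p (int_functional M f) x"
  shows clarke_subgradient_add:
      "u \<in> Lp M p \<Longrightarrow> v \<in> Lp M p \<Longrightarrow> \<phi> (\<lambda>t. u t + v t) = \<phi> u + \<phi> v"
    and clarke_subgradient_scaleR: "u \<in> Lp M p \<Longrightarrow> \<phi> (\<lambda>t. c *\<^sub>R u t) = c * \<phi> u"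
  using assms unfolding Lp_clarke_subdiff_def Lp_dual_def by blast+

text \<open>The lower bound is the upper bound for \<open>-v\<close>.\<close>

lemma clarke_subgradient_abs_le:
  assumes \<phi>: "\<phi> \<in> Lp_clarke_subdiff M p (int_functional M f) x" and v: "v \<in> Lp M p"
  shows "\<bar>\<phi> v\<bar> \<le> (\<integral>t. k t * norm (v t) \<partial>M)"
proof -
  have le: "\<phi> w \<le> (\<integral>t. k t * norm (w t) \<partial>M)" if w: "w \<in> Lp M p" for w
  proof -
    have "D t (w t) \<le> k t * norm (w t)" for t using D_bound[of t "w t"] by linarith
    then have "(\<integral>t. D t (w t) \<partial>M) \<le> (\<integral>t. k t * norm (w t) \<partial>M)"
      by (intro integral_mono integrable_D integrable_k_norm w)
    with clarke_subgradient_le[OF \<phi> w] show ?thesis by linarith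
  qed
  show ?thesis
    using le[OF v] le[OF Lp_scaleR[OF v, of "-1"]] clarke_subgradient_scaleR[OF \<phi> v, of "-1"]
    by (simp add: abs_le_iff)
qed

lemma clarke_subgradient_diff_le:
  assumes \<phi>: "\<phi> \<in> Lp_clarke_subdiff M p (int_functional M f) x"
    and u: "u \<in> Lp M p" and v: "v \<in> Lp M p"
  shows "\<bar>\<phi> u - \<phi> v\<bar> \<le> (\<integral>t. k t * norm (u t - v t) \<partial>M)"
proof -
  have "\<phi> (\<lambda>t. u t - v t) = \<phi> u - \<phi> v"
    using clarke_subgradient_add[OF \<phi> u Lp_scaleR[OF v, of "-1"]] clarke_subgradient_scaleR[OF \<phi> v, of "-1"]
    by simp
  then show ?thesis
    using clarke_subgradient_abs_le[OF \<phi> Lp_diff[OF u v exponents(2)]] by simp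
qed

text \<open>A constant function need not belong to \<open>L\<^sup>p\<close> when the measure is infinite. Multiplied by \<open>weight\<close> every
  bounded strongly measurable function does, and its product with \<open>k\<close> stays below the integrable function
  \<open>base_weight\<close>.\<close>

definition base_weight :: "'t \<Rightarrow> real" where
  "base_weight = (SOME b. b \<in> borel_measurable M \<and> (\<forall>t. 0 < b t \<and> b t \<le> 1) \<and> integrable M b)"

definition weight :: "'t \<Rightarrow> real" where
  "weight t = base_weight t / (1 + k t)"

lemma base_weight:
  shows base_weight_measurable[measurable]: "base_weight \<in> borel_measurable M"
    and base_weight_pos: "0 < base_weight t" and base_weight_le_1: "base_weight t \<le> 1"
    and base_weight_integrable: "integrable M base_weight"
proof -
  have "\<exists>b :: 't \<Rightarrow> real. b \<in> borel_measurable M \<and> (\<forall>t. 0 < b t \<and> b t \<le> 1) \<and> integrable M b"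
    using obtain_positive_integrable_function by metis
  from someI_ex[OF this] have "base_weight \<in> borel_measurable M \<and>
      (\<forall>t. 0 < base_weight t \<and> base_weight t \<le> 1) \<and> integrable M base_weight"
    unfolding base_weight_def .
  then show "base_weight \<in> borel_measurable M" "0 < base_weight t" "base_weight t \<le> 1"
    "integrable M base_weight" by auto
qed

lemma weight_measurable[measurable]: "weight \<in> borel_measurable M"
  unfolding weight_def[abs_def] by measurable

lemma weight_pos: "0 < weight t"
  unfolding weight_def using base_weight_pos[of t] k_nonneg[of t] by simp

lemma weight_mult_eq: "(1 + k t) * weight t = base_weight t"
  unfolding weight_def using k_nonneg[of t] by simp

lemma weight_le: "weight t \<le> base_weight t" and k_weight_le: "k t * weight t \<le> base_weight t"
proof -
  have "weight t + k t * weight t = base_weight t" using weight_mult_eq[of t] by (simp add: distrib_right)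
  moreover have "0 \<le> k t * weight t" using k_nonneg weight_pos[of t] by simp
  ultimately show "weight t \<le> base_weight t" "k t * weight t \<le> base_weight t"
    using weight_pos[of t] by linarith+
qed

lemma weight_scaleR_Lp:
  fixes u :: "'t \<Rightarrow> 'a"
  assumes u: "strongly_measurable M u" "\<And>t. norm (u t) \<le> C"
  shows "(\<lambda>t. weight t *\<^sub>R u t) \<in> Lp M p"
proof -
  define P where "P = enn2real p"
  have P: "1 \<le> P" unfolding P_def by (rule one_le_enn2real[OF exponents(1,2)])
  have sm: "strongly_measurable M (\<lambda>t. weight t *\<^sub>R u t)"
    by (intro strongly_measurable_scaleR strongly_measurable_real weight_measurable u)
  have "integrable M (\<lambda>t. norm (weight t *\<^sub>R u t) powr P)"
  proof (rule Bochner_Integration.integrable_bound)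
    show "integrable M (\<lambda>t. C powr P * base_weight t)" using base_weight_integrable by simp
    show "(\<lambda>t. norm (weight t *\<^sub>R u t) powr P) \<in> borel_measurable M"
      using borel_measurable_norm_strong[OF sm] by measurable
    have "norm (weight t *\<^sub>R u t) powr P \<le> C powr P * base_weight t" for t
    proof -
      have "weight t powr P \<le> weight t powr 1"
        using weight_pos[of t] weight_le[of t] base_weight_le_1[of t] P by (intro powr_mono') auto
      then have "weight t powr P \<le> base_weight t" using weight_pos[of t] weight_le[of t] by simp
      moreover have "norm (u t) powr P \<le> C powr P" using u(2)[of t] P by (intro powr_mono2) auto
      ultimately have "weight t powr P * norm (u t) powr P \<le> base_weight t * C powr P"
        using base_weight_pos[of t] by (intro mult_mono) auto
      then show ?thesis using weight_pos[of t] by (simp add: powr_mult mult.commute)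
    qed
    then show "AE t in M. norm (norm (weight t *\<^sub>R u t) powr P) \<le> norm (C powr P * base_weight t)"
      using base_weight_pos by (simp add: abs_mult less_imp_le)
  qed
  with sm exponents(2) show ?thesis by (simp add: Lp_def P_def)
qed

lemma weight_indicator_Lp:
  fixes z :: 'a
  assumes "E \<in> sets M"
  shows "(\<lambda>t. weight t *\<^sub>R indicator E t *\<^sub>R z) \<in> Lp M p"
  by (rule weight_scaleR_Lp[of _ "norm z"])
     (use assms in \<open>auto intro!: strongly_measurable_indicator strongly_measurable_simple split: split_indicator\<close>)

text \<open>The set function \<open>E \<mapsto> \<phi>(1\<^sub>E weight z)\<close> is dominated by \<open>\<parallel>z\<parallel>\<close> times the finite measure with density
  \<open>base_weight\<close>, because \<open>k weight \<le> base_weight\<close>.\<close>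

lemma clarke_subgradient_scalar_density:
  assumes \<phi>: "\<phi> \<in> Lp_clarke_subdiff M p (int_functional M f) x"
  shows "\<exists>u. u \<in> borel_measurable M \<and> (AE t in M. \<bar>u t\<bar> \<le> norm z) \<and>
    (\<forall>E\<in>sets M. \<phi> (\<lambda>t. weight t *\<^sub>R indicator E t *\<^sub>R z) = (\<integral>t. indicator E t * (base_weight t * u t) \<partial>M))"
proof -
  define N where "N = density M base_weight"
  have sN: "sets N = sets M" unfolding N_def by simp
  have eN: "emeasure N A = ennreal (\<integral>t. indicator A t * base_weight t \<partial>M)" 
    and mN: "measure N A = (\<integral>t. indicator A t * base_weight t \<partial>M)" if A: "A \<in> sets M" for A
  proof -
    have "emeasure N A = (\<integral>\<^sup>+t. ennreal (indicator A t * base_weight t) \<partial>M)"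
      unfolding N_def using base_weight_pos A
      by (subst emeasure_density) (auto intro!: nn_integral_cong split: split_indicator)
    also have "\<dots> = ennreal (\<integral>t. indicator A t * base_weight t \<partial>M)"
      using base_weight_pos A integrable_mult_indicator[OF A base_weight_integrable]
      by (intro nn_integral_eq_integral) (auto intro!: AE_I2 simp: less_imp_le)
    finally show e: "emeasure N A = ennreal (\<integral>t. indicator A t * base_weight t \<partial>M)" .
    have "0 \<le> (\<integral>t. indicator A t * base_weight t \<partial>M)"
      using base_weight_pos by (intro integral_nonneg_AE AE_I2) (simp add: less_imp_le)
    then show "measure N A = (\<integral>t. indicator A t * base_weight t \<partial>M)" using e by (simp add: measure_def)
  qed
  interpret N: finite_measure N
    by (rule finite_measureI) (use eN[OF sets.top] in \<open>simp add: N_def\<close>)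
  define m where "m E = \<phi> (\<lambda>t. weight t *\<^sub>R indicator E t *\<^sub>R z)" for E
  note Lp = weight_indicator_Lp[of _ z]
  obtain u where u: "u \<in> borel_measurable N" "AE t in N. \<bar>u t\<bar> \<le> norm z"
    "\<And>E. E \<in> sets N \<Longrightarrow> m E = (\<integral>t. indicator E t * u t \<partial>N)"
  proof (rule N.dominated_set_function_density[of m "norm z"])
    fix A B assume AB: "A \<in> sets N" "B \<in> sets N" "A \<inter> B = {}"
    have "m (A \<union> B) = \<phi> (\<lambda>t. weight t *\<^sub>R indicator A t *\<^sub>R z + weight t *\<^sub>R indicator B t *\<^sub>R z)"
      unfolding m_def using AB(3) by (intro arg_cong[where f = \<phi>] ext) (auto split: split_indicator)
    also have "\<dots> = m A + m B"
      unfolding m_def by (rule clarke_subgradient_add[OF \<phi>]) (use AB sN Lp in auto)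
    finally show "m (A \<union> B) = m A + m B" .
  next
    fix A assume "A \<in> sets N"
    then have A: "A \<in> sets M" by (simp add: sN)
    have "\<bar>m A\<bar> \<le> (\<integral>t. k t * norm (weight t *\<^sub>R indicator A t *\<^sub>R z) \<partial>M)"
      unfolding m_def by (rule clarke_subgradient_abs_le[OF \<phi> Lp[OF A]])
    also have "\<dots> \<le> (\<integral>t. norm z * (indicator A t * base_weight t) \<partial>M)"
    proof (rule integral_mono[OF integrable_k_norm[OF Lp[OF A]]])
      show "integrable M (\<lambda>t. norm z * (indicator A t * base_weight t))"
        using integrable_mult_indicator[OF A base_weight_integrable] by simp
      fix t
      have "norm z * (k t * weight t) \<le> norm z * base_weight t" using k_weight_le by (rule mult_left_mono) simp
      then show "k t * norm (weight t *\<^sub>R indicator A t *\<^sub>R z) \<le> norm z * (indicator A t * base_weight t)"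
        using weight_pos[of t] by (auto split: split_indicator simp: ac_simps)
    qed
    also have "\<dots> = norm z * measure N A" using mN[OF A] by simp
    finally show "\<bar>m A\<bar> \<le> norm z * measure N A" .
  qed auto
  have mu: "u \<in> borel_measurable M" using u(1) by (simp add: N_def)
  have "AE t in M. \<bar>u t\<bar> \<le> norm z" using u(2) AE_density_pos[OF base_weight_measurable base_weight_pos] unfolding N_def by simp
  moreover have "m E = (\<integral>t. indicator E t * (base_weight t * u t) \<partial>M)" if E: "E \<in> sets M" for E
  proof -
    have "m E = (\<integral>t. indicator E t * u t \<partial>N)" using u(3) E sN by simp
    also have "\<dots> = (\<integral>t. base_weight t * (indicator E t * u t) \<partial>M)"
      unfolding N_def using base_weight_pos E mu by (subst integral_density) (auto intro!: AE_I2 simp: less_imp_le)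
    finally show ?thesis by (simp add: ac_simps)
  qed
  ultimately show ?thesis using mu unfolding m_def by blast
qed

text \<open>The scalar densities inherit additivity and homogeneity from \<open>\<phi>\<close>, by uniqueness of densities, so
  they come from a dual-valued \<open>\<eta>\<close>. The factor \<open>1 + k\<close> undoes the quotient
  \<open>weight / base_weight\<close>.\<close>

lemma clarke_subgradient_density:
  assumes A: "asplund TYPE('a)"
    and \<phi>: "\<phi> \<in> Lp_clarke_subdiff M p (int_functional M f) x"
  obtains \<xi> :: "'t \<Rightarrow> 'a \<Rightarrow>\<^sub>L real" where "strongly_measurable M \<xi>"
    "\<forall>z. integrable M (\<lambda>t. weight t * \<xi> t z)"
    "\<forall>z. \<forall>E\<in>sets M. \<phi> (\<lambda>t. weight t *\<^sub>R indicator E t *\<^sub>R z) = (\<integral>t. indicator E t * (weight t * \<xi> t z) \<partial>M)"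
proof -
  obtain u where u: "\<And>z. u z \<in> borel_measurable M" "\<And>z. AE t in M. \<bar>u z t\<bar> \<le> norm z"
    and rep: "\<And>z E. E \<in> sets M \<Longrightarrow>
      \<phi> (\<lambda>t. weight t *\<^sub>R indicator E t *\<^sub>R z) = (\<integral>t. indicator E t * (base_weight t * u z t) \<partial>M)"
  proof -
    have "\<forall>z. \<exists>u. u \<in> borel_measurable M \<and> (AE t in M. \<bar>u t\<bar> \<le> norm z) \<and>
      (\<forall>E\<in>sets M. \<phi> (\<lambda>t. weight t *\<^sub>R indicator E t *\<^sub>R z) = (\<integral>t. indicator E t * (base_weight t * u t) \<partial>M))"
      by (intro allI clarke_subgradient_scalar_density[OF \<phi>])
    from choice[OF this] show ?thesis using that by blast
  qed
  note Lp = weight_indicator_Lp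
  have int: "integrable M (\<lambda>t. base_weight t * u z t)" for z
  proof (rule Bochner_Integration.integrable_bound)
    show "integrable M (\<lambda>t. base_weight t * norm z)" using base_weight_integrable by simp
    show "(\<lambda>t. base_weight t * u z t) \<in> borel_measurable M" using base_weight_measurable u(1) by measurable
    show "AE t in M. norm (base_weight t * u z t) \<le> norm (base_weight t * norm z)"
      using u(2)[of z] by eventually_elim (use base_weight_pos in \<open>simp add: abs_mult less_imp_le\<close>)
  qed
  have intE: "integrable M (\<lambda>t. indicator E t * (base_weight t * u z t))" if "E \<in> sets M" for E z
    using integrable_mult_indicator[OF that int] by simp
  have cancel: "AE t in M. g t = h t"
    if gh: "integrable M (\<lambda>t. base_weight t * g t)" "integrable M (\<lambda>t. base_weight t * h t)"
      and eq: "\<And>E. E \<in> sets M \<Longrightarrow> (\<integral>t. indicator E t * (base_weight t * g t) \<partial>M) = (\<integral>t. indicator E t * (base_weight t * h t) \<partial>M)"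
    for g h :: "'t \<Rightarrow> real"
  proof -
    have "AE t in M. base_weight t * g t = base_weight t * h t"
      by (rule density_unique_real[OF gh]) (use eq in \<open>simp add: set_lebesgue_integral_def\<close>)
    then show ?thesis by eventually_elim (use base_weight_pos in \<open>simp add: less_imp_neq[symmetric]\<close>)
  qed
  have add: "AE t in M. u (y + z) t = u y t + u z t" for y z
  proof (rule cancel)
    show "integrable M (\<lambda>t. base_weight t * (u y t + u z t))"
      using int[of y] int[of z] by (simp add: distrib_left)
    fix E assume E: "E \<in> sets M"
    have "(\<integral>t. indicator E t * (base_weight t * u (y + z) t) \<partial>M) = \<phi> (\<lambda>t. weight t *\<^sub>R indicator E t *\<^sub>R y + weight t *\<^sub>R indicator E t *\<^sub>R z)"
      using rep[OF E, of "y + z"] by (simp add: scaleR_add_right)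
    also have "\<dots> = (\<integral>t. indicator E t * (base_weight t * u y t) \<partial>M) + (\<integral>t. indicator E t * (base_weight t * u z t) \<partial>M)"
      using clarke_subgradient_add[OF \<phi> Lp[OF E] Lp[OF E]] rep[OF E] by simp
    also have "\<dots> = (\<integral>t. indicator E t * (base_weight t * (u y t + u z t)) \<partial>M)"
      using intE[OF E, of y] intE[OF E, of z] by (simp add: distrib_left)
    finally show "(\<integral>t. indicator E t * (base_weight t * u (y + z) t) \<partial>M) = (\<integral>t. indicator E t * (base_weight t * (u y t + u z t)) \<partial>M)" .
  qed (rule int)
  have hom: "AE t in M. u (c *\<^sub>R z) t = c * u z t" for c z
  proof (rule cancel)
    show "integrable M (\<lambda>t. base_weight t * (c * u z t))"
      using int[of z] by (simp add: mult.left_commute)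
    fix E assume E: "E \<in> sets M"
    have "(\<integral>t. indicator E t * (base_weight t * u (c *\<^sub>R z) t) \<partial>M) = \<phi> (\<lambda>t. c *\<^sub>R weight t *\<^sub>R indicator E t *\<^sub>R z)"
      using rep[OF E, of "c *\<^sub>R z"] by (simp add: ac_simps)
    also have "\<dots> = c * (\<integral>t. indicator E t * (base_weight t * u z t) \<partial>M)"
      using clarke_subgradient_scaleR[OF \<phi> Lp[OF E]] rep[OF E] by simp
    also have "\<dots> = (\<integral>t. indicator E t * (base_weight t * (c * u z t)) \<partial>M)"
      by (simp add: mult.left_commute flip: integral_mult_right_zero)
    finally show "(\<integral>t. indicator E t * (base_weight t * u (c *\<^sub>R z) t) \<partial>M) = (\<integral>t. indicator E t * (base_weight t * (c * u z t)) \<partial>M)" .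
  qed (rule int)
  obtain \<eta> :: "'t \<Rightarrow> 'a \<Rightarrow>\<^sub>L real" where \<eta>: "strongly_measurable M \<eta>" "\<And>z. AE t in M. \<eta> t z = u z t"
    using asplund_dual_density[OF A sigma_finite_measure_axioms u add hom] by blast
  define \<xi> where "\<xi> t = (1 + k t) *\<^sub>R \<eta> t" for t
  have sm: "strongly_measurable M \<xi>" unfolding \<xi>_def[abs_def]
    by (intro strongly_measurable_scaleR strongly_measurable_real \<eta>) measurable
  have w\<xi>: "weight t * \<xi> t z = base_weight t * \<eta> t z" for t z
    using k_nonneg[of t] unfolding weight_def \<xi>_def by (simp add: blinfun.scaleR_left)
  have ae: "AE t in M. base_weight t * u z t = weight t * \<xi> t z" for z
    using \<eta>(2)[of z] by eventually_elim (simp add: w\<xi>)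
  have m\<eta>: "(\<lambda>t. \<eta> t z) \<in> borel_measurable M" for z
    by (rule borel_measurable_blinfun_strong[OF \<eta>(1)]) (simp add: strongly_measurable_simple)
  have mw\<xi>: "(\<lambda>t. weight t * \<xi> t z) \<in> borel_measurable M" for z
    unfolding w\<xi> using base_weight_measurable m\<eta> by measurable
  have int\<xi>: "integrable M (\<lambda>t. weight t * \<xi> t z)" for z
    using integrable_cong_AE[OF _ mw\<xi> ae, THEN iffD1, OF _ int] int by blast
  have "\<phi> (\<lambda>t. weight t *\<^sub>R indicator E t *\<^sub>R z) = (\<integral>t. indicator E t * (weight t * \<xi> t z) \<partial>M)" if E: "E \<in> sets M" for z E
    unfolding rep[OF E]
  proof (rule integral_cong_AE)
    show "AE t in M. indicator E t * (base_weight t * u z t) = indicator E t * (weight t * \<xi> t z)"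
      using ae[of z] by eventually_elim simp
  qed (use E base_weight_measurable u(1)[of z] mw\<xi>[of z] in \<open>auto intro!: borel_measurable_times\<close>)
  with sm int\<xi> that show ?thesis by blast
qed

text \<open>Restricting the test function \<open>weight z\<close> to arbitrary measurable sets localizes the inequality
  between integrals; positive homogeneity of \<open>D\<close> removes the weight.\<close>

lemma density_in_clarke_subdiff:
  fixes \<xi> :: "'t \<Rightarrow> 'a \<Rightarrow>\<^sub>L real"
  assumes ir: "inner_regular M"
    and \<phi>: "\<phi> \<in> Lp_clarke_subdiff M p (int_functional M f) x"
    and \<xi>: "strongly_measurable M \<xi>" "\<And>z. integrable M (\<lambda>t. weight t * \<xi> t z)"
      "\<And>z E. E \<in> sets M \<Longrightarrow> \<phi> (\<lambda>t. weight t *\<^sub>R indicator E t *\<^sub>R z) = (\<integral>t. indicator E t * (weight t * \<xi> t z) \<partial>M)"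
  shows "AE t in M. \<xi> t \<in> clarke_subdiff (f t) (x t)"
proof -
  have "AE t in M. \<xi> t z \<le> D t z" for z
  proof -
    have sm: "strongly_measurable M (\<lambda>t. z)" by (simp add: strongly_measurable_simple)
    have wz: "(\<lambda>t. weight t *\<^sub>R z) \<in> Lp M p" by (rule weight_scaleR_Lp[OF sm, of "norm z"]) simp
    have intD: "integrable M (\<lambda>t. D t (weight t *\<^sub>R z))" by (rule integrable_D[OF wz])
    have "AE t in M. weight t * \<xi> t z \<le> D t (weight t *\<^sub>R z)"
    proof (rule AE_le_of_set_integrals_le[OF \<xi>(2) intD])
      fix E assume E: "E \<in> sets M"
      have "(\<lambda>t. weight t *\<^sub>R indicator E t *\<^sub>R z) \<in> Lp M p"
        by (rule weight_indicator_Lp[OF E])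
      then have "\<phi> (\<lambda>t. weight t *\<^sub>R indicator E t *\<^sub>R z) \<le> (\<integral>t. D t (weight t *\<^sub>R indicator E t *\<^sub>R z) \<partial>M)"
        by (rule clarke_subgradient_le[OF \<phi>])
      also have "(\<integral>t. D t (weight t *\<^sub>R indicator E t *\<^sub>R z) \<partial>M) = (\<integral>t. indicator E t * D t (weight t *\<^sub>R z) \<partial>M)"
      proof (rule Bochner_Integration.integral_cong[OF refl])
        fix t
        have "D t 0 = 0" using D_bound[of t 0] by simp
        then show "D t (weight t *\<^sub>R indicator E t *\<^sub>R z) = indicator E t * D t (weight t *\<^sub>R z)"
          by (auto split: split_indicator)
      qed
      finally show "(\<integral>t. indicator E t * (weight t * \<xi> t z) \<partial>M) \<le> (\<integral>t. indicator E t * D t (weight t *\<^sub>R z) \<partial>M)"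
        unfolding \<xi>(3)[OF E] .
    qed
    then show ?thesis
    proof eventually_elim
      case (elim t)
      have "D t (weight t *\<^sub>R z) \<le> weight t * D t z"
        unfolding D_def by (rule clarke_deriv_scaleR_le[OF f_lipschitz weight_pos])
      with elim have "weight t * \<xi> t z \<le> weight t * D t z" by linarith
      then show ?case using weight_pos[of t] by simp
    qed
  qed
  from AE_all_directions[OF ir \<xi>(1) this] show ?thesis
    by eventually_elim (simp add: clarke_subdiff_def clarke_deriv_eq_D)
qed

lemma clarke_subdiff_norm_le:
  assumes "\<zeta> \<in> clarke_subdiff (f t) (x t)"
  shows "norm \<zeta> \<le> k t"
proof (rule norm_blinfun_bound[OF k_nonneg])
  fix z
  have *: "\<zeta> z \<le> k t * norm z" for z
    using assms D_bound[of t z] unfolding clarke_subdiff_def clarke_deriv_eq_D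
    by (auto simp: abs_le_iff intro: order_trans)
  from *[of z] *[of "- z"] show "norm (\<zeta> z) \<le> k t * norm z"
    by (simp add: blinfun.minus_right abs_le_iff)
qed

text \<open>Both sides are linear in \<open>v\<close> and controlled by \<open>\<integral> k \<parallel>v\<parallel>\<close>, so it is enough to approximate \<open>v\<close> by
  weighted simple functions, dominated by \<open>2 \<parallel>v\<parallel>\<close>.\<close>

lemma clarke_subgradient_represented:
  fixes \<xi> :: "'t \<Rightarrow> 'a \<Rightarrow>\<^sub>L real"
  assumes \<phi>: "\<phi> \<in> Lp_clarke_subdiff M p (int_functional M f) x"
    and \<xi>: "strongly_measurable M \<xi>" "AE t in M. norm (\<xi> t) \<le> k t"
      "\<And>z E. E \<in> sets M \<Longrightarrow> \<phi> (\<lambda>t. weight t *\<^sub>R indicator E t *\<^sub>R z) = (\<integral>t. indicator E t * (weight t * \<xi> t z) \<partial>M)"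
    and v: "v \<in> Lp M p"
  shows "\<phi> v = (\<integral>t. \<xi> t (v t) \<partial>M)"
proof -
  have bound: "AE t in M. \<bar>\<xi> t (u t)\<bar> \<le> k t * norm (u t)" for u :: "'t \<Rightarrow> 'a"
    using \<xi>(2)
  proof eventually_elim
    case (elim t)
    have "\<bar>\<xi> t (u t)\<bar> \<le> norm (\<xi> t) * norm (u t)" using norm_blinfun[of "\<xi> t" "u t"] by simp
    also have "\<dots> \<le> k t * norm (u t)" using elim by (rule mult_right_mono) simp
    finally show ?case .
  qed
  have int: "integrable M (\<lambda>t. \<xi> t (u t))" if u: "u \<in> Lp M p" for u
  proof (rule Bochner_Integration.integrable_bound[OF integrable_k_norm[OF u]])
    show "(\<lambda>t. \<xi> t (u t)) \<in> borel_measurable M"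
      by (intro borel_measurable_blinfun_strong \<xi> Lp_strongly_measurable[OF u])
    show "AE t in M. norm (\<xi> t (u t)) \<le> norm (k t * norm (u t))"
      using bound[of u] by eventually_elim (simp add: abs_mult k_nonneg)
  qed
  have simple: "(\<lambda>t. weight t *\<^sub>R s t) \<in> Lp M p \<and> \<phi> (\<lambda>t. weight t *\<^sub>R s t) = (\<integral>t. \<xi> t (weight t *\<^sub>R s t) \<partial>M)"
    if s: "simple_function M s" for s :: "'t \<Rightarrow> 'a"
  proof -
    let ?E = "\<lambda>c. s -` {c} \<inter> space M"
    have E: "?E c \<in> sets M" for c using simple_functionD(2)[OF s] .
    have piece: "(\<lambda>t. weight t *\<^sub>R indicator (?E c) t *\<^sub>R c) \<in> Lp M p" for c
      by (rule weight_indicator_Lp[OF E])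
    have "(\<lambda>t. weight t *\<^sub>R (\<Sum>c\<in>C. indicator (?E c) t *\<^sub>R c)) \<in> Lp M p \<and>
        \<phi> (\<lambda>t. weight t *\<^sub>R (\<Sum>c\<in>C. indicator (?E c) t *\<^sub>R c)) =
        (\<integral>t. \<xi> t (weight t *\<^sub>R (\<Sum>c\<in>C. indicator (?E c) t *\<^sub>R c)) \<partial>M)" if "finite C" for C
      using that
    proof induction
      case empty
      have "(\<lambda>t. weight t *\<^sub>R (0::'a)) \<in> Lp M p"
        by (rule weight_scaleR_Lp[of _ 0]) (auto intro: strongly_measurable_simple)
      then show ?case using \<xi>(3)[of "{}" 0] by simp
    next
      case (insert c C)
      let ?S = "\<lambda>t. weight t *\<^sub>R (\<Sum>c\<in>C. indicator (?E c) t *\<^sub>R c)"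
      let ?p = "\<lambda>t. weight t *\<^sub>R indicator (?E c) t *\<^sub>R c"
      have eq: "weight t *\<^sub>R (\<Sum>c\<in>insert c C. indicator (?E c) t *\<^sub>R c) = ?p t + ?S t" for t
        by (simp only: sum.insert[OF insert.hyps] scaleR_add_right)
      have S: "?S \<in> Lp M p" "\<phi> ?S = (\<integral>t. \<xi> t (?S t) \<partial>M)" using insert.IH by auto
      have p: "\<phi> ?p = (\<integral>t. \<xi> t (?p t) \<partial>M)"
        unfolding \<xi>(3)[OF E] by (simp add: blinfun.scaleR_right ac_simps)
      have "\<phi> (\<lambda>t. ?p t + ?S t) = (\<integral>t. \<xi> t (?p t) \<partial>M) + (\<integral>t. \<xi> t (?S t) \<partial>M)"
        unfolding clarke_subgradient_add[OF \<phi> piece S(1)] p S(2) ..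
      also have "\<dots> = (\<integral>t. \<xi> t (?p t + ?S t) \<partial>M)"
        unfolding blinfun.add_right
        by (rule Bochner_Integration.integral_add[symmetric]) (intro int piece S)+
      finally show ?case unfolding eq using Lp_add[OF piece S(1) exponents(2)] by blast
    qed
    from this[OF simple_functionD(1)[OF s]] have
      "(\<lambda>t. weight t *\<^sub>R (\<Sum>c\<in>s ` space M. indicator (?E c) t *\<^sub>R c)) \<in> Lp M p \<and>
        \<phi> (\<lambda>t. weight t *\<^sub>R (\<Sum>c\<in>s ` space M. indicator (?E c) t *\<^sub>R c)) =
        (\<integral>t. \<xi> t (weight t *\<^sub>R (\<Sum>c\<in>s ` space M. indicator (?E c) t *\<^sub>R c)) \<partial>M)" .
    moreover have "(\<Sum>c\<in>s ` space M. indicator (?E c) t *\<^sub>R c) = s t" for t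
    proof -
      have "(\<Sum>c\<in>s ` space M. indicator (?E c) t *\<^sub>R c) = (\<Sum>c\<in>s ` space M. if c = s t then c else 0)"
        by (intro sum.cong) (auto simp: space_UNIV split: split_indicator)
      also have "\<dots> = s t" using simple_functionD(1)[OF s] by (simp add: space_UNIV)
      finally show ?thesis .
    qed
    ultimately show ?thesis by simp
  qed
  have smv: "strongly_measurable M v" by (rule Lp_strongly_measurable[OF v])
  have "strongly_measurable M (\<lambda>t. inverse (weight t) *\<^sub>R v t)"
    using weight_measurable by (intro strongly_measurable_scaleR strongly_measurable_real smv) measurable
  then obtain s where s: "\<And>n. simple_function M (s n)" "AE t in M. (\<lambda>n. s n t) \<longlonglongrightarrow> inverse (weight t) *\<^sub>R v t"
    unfolding strongly_measurable_def by blast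
  \<comment> \<open>Cutting off where the bound fails keeps the functions simple and does not affect the limit.\<close>
  define r where "r n t = (if norm (weight t *\<^sub>R s n t) \<le> 2 * norm (v t) then s n t else 0)" for n t
  define y where "y n t = weight t *\<^sub>R r n t" for n t
  have r: "simple_function M (r n)" for n
  proof -
    have "(\<lambda>t. norm (s n t)) \<in> borel_measurable M"
      by (intro borel_measurable_norm_strong strongly_measurable_simple s)
    then have "{t\<in>space M. norm (weight t *\<^sub>R s n t) \<le> 2 * norm (v t)} \<in> sets M"
      using weight_measurable borel_measurable_norm_strong[OF smv] by simp
    then show ?thesis unfolding r_def[abs_def] by (intro simple_function_If s) auto
  qed
  have y: "y n \<in> Lp M p" "\<phi> (y n) = (\<integral>t. \<xi> t (y n t) \<partial>M)" for n
    using simple[OF r[of n]] by (auto simp: y_def[abs_def])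
  have ybound: "norm (y n t) \<le> 2 * norm (v t)" for n t
    unfolding y_def r_def by auto
  have ylim: "AE t in M. (\<lambda>n. y n t) \<longlonglongrightarrow> v t"
    using s(2)
  proof eventually_elim
    case (elim t)
    have ws: "(\<lambda>n. weight t *\<^sub>R s n t) \<longlonglongrightarrow> v t"
      using tendsto_scaleR[OF tendsto_const elim, of "weight t"] weight_pos[of t] by simp
    show ?case
    proof (cases "v t = 0")
      case True
      then have "y n t = 0" for n using ybound[of n t] by simp
      then show ?thesis using True by simp
    next
      case False
      have "\<forall>\<^sub>F n in sequentially. norm (weight t *\<^sub>R s n t) < 2 * norm (v t)"
        using False by (intro order_tendstoD(2)[OF tendsto_norm[OF ws]]) simp
      then have "\<forall>\<^sub>F n in sequentially. weight t *\<^sub>R s n t = y n t"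
        by eventually_elim (simp add: y_def r_def)
      with ws show ?thesis by (rule Lim_transform_eventually)
    qed
  qed
  have "(\<lambda>n. \<integral>t. k t * norm (y n t - v t) \<partial>M) \<longlonglongrightarrow> (\<integral>t. 0 \<partial>M)"
  proof (rule integral_dominated_convergence[where w = "\<lambda>t. 3 * (k t * norm (v t))"])
    show "AE t in M. (\<lambda>n. k t * norm (y n t - v t)) \<longlonglongrightarrow> 0"
      using ylim by eventually_elim (auto intro!: tendsto_eq_intros)
    show "AE t in M. norm (k t * norm (y n t - v t)) \<le> 3 * (k t * norm (v t))" for n
    proof (rule AE_I2)
      fix t
      have "norm (y n t - v t) \<le> 3 * norm (v t)"
        using norm_triangle_ineq4[of "y n t" "v t"] ybound[of n t] by linarith
      from mult_left_mono[OF this k_nonneg[of t]] show "norm (k t * norm (y n t - v t)) \<le> 3 * (k t * norm (v t))"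
        by (simp add: abs_mult k_nonneg)
    qed
  qed (use integrable_k_norm[OF v] integrable_k_norm[OF Lp_diff[OF y(1) v exponents(2)]] in auto)
  then have "(\<lambda>n. \<integral>t. k t * norm (y n t - v t) \<partial>M) \<longlonglongrightarrow> 0" by simp
  then have "(\<lambda>n. \<phi> (y n) - \<phi> v) \<longlonglongrightarrow> 0"
    by (rule Lim_null_comparison[rotated])
       (use clarke_subgradient_diff_le[OF \<phi> y(1) v] in \<open>simp add: always_eventually\<close>)
  then have "(\<lambda>n. \<phi> (y n)) \<longlonglongrightarrow> \<phi> v" by (rule LIM_zero_cancel)
  moreover have "(\<lambda>n. \<phi> (y n)) \<longlonglongrightarrow> (\<integral>t. \<xi> t (v t) \<partial>M)"
    unfolding y(2)
  proof (rule integral_dominated_convergence[where w = "\<lambda>t. 2 * (k t * norm (v t))"])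
    show "AE t in M. (\<lambda>n. \<xi> t (y n t)) \<longlonglongrightarrow> \<xi> t (v t)"
      using ylim by eventually_elim (auto intro!: tendsto_intros)
    show "AE t in M. norm (\<xi> t (y n t)) \<le> 2 * (k t * norm (v t))" for n
      using bound[of "y n"]
    proof eventually_elim
      case (elim t)
      with mult_left_mono[OF ybound[of n t] k_nonneg[of t]] show ?case by simp
    qed
  qed (use integrable_k_norm[OF v] int[OF v] int[OF y(1)] in auto)
  ultimately show ?thesis by (rule LIMSEQ_unique)
qed

lemma clarke_subgradient_integral_selection:
  assumes A: "asplund TYPE('a)" and ir: "inner_regular M"
    and \<phi>: "\<phi> \<in> Lp_clarke_subdiff M p (int_functional M f) x"
  shows "\<exists>\<xi>\<in>Lp M q. (\<forall>v\<in>Lp M p. \<phi> v = (\<integral>t. blinfun_apply (\<xi> t) (v t) \<partial>M)) \<and>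
    (AE t in M. \<xi> t \<in> clarke_subdiff (f t) (x t))"
proof -
  obtain \<xi> :: "'t \<Rightarrow> 'a \<Rightarrow>\<^sub>L real" where sm: "strongly_measurable M \<xi>"
    and "\<forall>z. integrable M (\<lambda>t. weight t * \<xi> t z)"
      "\<forall>z. \<forall>E\<in>sets M. \<phi> (\<lambda>t. weight t *\<^sub>R indicator E t *\<^sub>R z) = (\<integral>t. indicator E t * (weight t * \<xi> t z) \<partial>M)"
    using clarke_subgradient_density[OF A \<phi>] .
  then have int: "\<And>z. integrable M (\<lambda>t. weight t * \<xi> t z)"
    and rep: "\<And>z E. E \<in> sets M \<Longrightarrow>
      \<phi> (\<lambda>t. weight t *\<^sub>R indicator E t *\<^sub>R z) = (\<integral>t. indicator E t * (weight t * \<xi> t z) \<partial>M)"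
    by blast+
  have sel: "AE t in M. \<xi> t \<in> clarke_subdiff (f t) (x t)"
    by (rule density_in_clarke_subdiff[OF ir \<phi> sm int rep])
  then have bound: "AE t in M. norm (\<xi> t) \<le> k t"
    by eventually_elim (rule clarke_subdiff_norm_le)
  have "\<xi> \<in> Lp M q"
    by (rule Lp_dominated[OF k_Lq sm, of 1]) (use bound k_nonneg in auto)
  moreover have "\<phi> v = (\<integral>t. \<xi> t (v t) \<partial>M)" if "v \<in> Lp M p" for v
    by (rule clarke_subgradient_represented[OF \<phi> sm bound rep that])
  ultimately show ?thesis using sel by blast
qed

end

theorem theorem7p1:
  fixes M :: "'t::metric_space measure"
    and f :: "'t \<Rightarrow> 'a::banach \<Rightarrow> real"
    and k :: "'t \<Rightarrow> real"
    and x :: "'t \<Rightarrow> 'a"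
    and p q :: ennreal
  assumes "space M = UNIV"
    and "sets borel \<subseteq> sets M"
    and "complete_measure M"
    and "sigma_finite_measure M"
    and "inner_regular M"
    and "asplund TYPE('a)"
    and "1 \<le> p" and "p < \<infinity>" and "1 < q" and "1 / p + 1 / q = 1"
    and "lusin_integrand M (\<lambda>t z. ereal (f t z))"
    and "k \<in> Lp M q"
    and "\<And>t. (k t)-lipschitz_on UNIV (f t)"
    and "\<exists>u\<in>Lp M p. integrable M (\<lambda>t. f t (u t))"
    and "x \<in> Lp M p"
    and "lusin_integrand M (\<lambda>t v. clarke_deriv (f t) (x t) v)"
  shows "(\<forall>v\<in>Lp M p.
            integrable M (\<lambda>t. real_of_ereal (clarke_deriv (f t) (x t) (v t))) \<and>
            Lp_clarke_deriv M p (int_functional M f) x v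
              \<le> ereal (\<integral>t. real_of_ereal (clarke_deriv (f t) (x t) (v t)) \<partial>M)) \<and>
         (\<forall>\<phi>\<in>Lp_clarke_subdiff M p (int_functional M f) x.
            \<exists>\<xi>\<in>Lp M q.
              (\<forall>v\<in>Lp M p. \<phi> v = (\<integral>t. blinfun_apply (\<xi> t) (v t) \<partial>M)) \<and>
              (AE t in M. \<xi> t \<in> clarke_subdiff (f t) (x t)))"
proof -
  interpret lusin_lipschitz_integral M f k p q x
    using assms by (intro lusin_lipschitz_integral.intro lusin_lipschitz_integral_axioms.intro)
  show ?thesis
    using integrable_D Lp_clarke_deriv_le clarke_subgradient_integral_selection[OF assms(6,5)]
    unfolding D_def by blast
qed

end
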